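(* Let $\boldsymbol X,\boldsymbol X_i$, $i\ge 1$, be iid random vectors whose common distribution has standard case hidden domain of attraction, let $\tilde\nu^0$ be the associated Radon measure on $(0,\infty]^2$, and let $R^{1,(2)}_i,R^{2,(2)}_i$ be the modified anti-ranks, all as defined in the context. Then in $M_+((0,\infty]^2)$, $$\widehat{\tilde\nu^0_n}(\cdot):=\frac1k\sum_{i=1}^n\epsilon_{\left(k/R^{1,(2)}_i,\ k/R^{2,(2)}_i\right)}(\cdot)\Rightarrow\tilde\nu^0(\cdot)\qquad(k\to\infty,\ n/k\to\infty).$$
   Context: Notation. Superscripts denote components: $\boldsymbol x=(x^1,x^2)$; $x^{(2)}=x^1\wedge x^2$; $\boldsymbol 1=(1,1)$. $M_+(F)$ is the set of nonnegative Radon measures on $F$ with the vague topology; $\stackrel{v}{\rightarrow}$ is vague convergence; $\Rightarrow$ is weak convergence (here of random elements of $M_+$). $\epsilon_x$ is the unit point mass at $x$. $k=k(n)$ is a sequence with $k\to\infty$, $n/k\to\infty$ as $n\to\infty$. Standard case hidden domain of attraction. The distribution of $\boldsymbol X=(X^1,X^2)$ has standard case hidden domain of attraction on the cone $E^0$ (either $(-\infty,\infty]^2$ or $(0,\infty]^2$) if: (i) $X^1\stackrel{d}{=}X^2$; (ii) with $E=[-\infty,\infty]^2\setminus\{(-\infty,-\infty)\}$ or $E=[0,\infty]^2\setminus\{(0,0)\}$, there are $a_n>0$, $b_n\in\mathbb R$ such that $nP[(\boldsymbol X-b_n\boldsymbol 1)/a_n\in\cdot]\stackrel{v}{\rightarrow}\nu(\cdot)$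 in $M_+(E)$, where $\nu(\{\boldsymbol z\in E:z^1\le x^1,z^2\le x^2\}^c)=-\log G^1(x^1)-\log G^2(x^2)$ for nondegenerate extreme value distributions $G^1,G^2$ (asymptotic independence); (iii) there are $c_n>0$, $d_n\in\mathbb R$ and a nonzero $\nu^0\in M_+(E^0)$ with $nP[(\boldsymbol X-d_n\boldsymbol 1)/c_n\in\cdot]\stackrel{v}{\rightarrow}\nu^0(\cdot)$ in $M_+(E^0)$. The distribution of $X^{(2)}=X^1\wedge X^2$ is then in a maximal domain of attraction with constants $c_n,d_n$; the cone is $E^0=(0,\infty]^2$ if its extreme value index is positive and $(-\infty,\infty]^2$ otherwise. The measure $\tilde\nu^0$. Let $H^{(2)}$ be the distribution function of $X^{(2)}$ and $U^{(2)}(x)=1/(1-H^{(2)}(x))$ (extended valued). Under hidden domain of attraction, $nP[n^{-1}(U^{(2)}(X^1),U^{(2)}(X^2))\in\cdot]\stackrel{v}{\rightarrow}\tilde\nu^0(\cdot)$ in $M_+((0,\infty]^2)$, and this limit defines the Radon measure $\tilde\nu^0$. Modified anti-ranks. With $X^{(2)}_j=X^1_j\wedge X^2_j$, for $i=1,\dots,n$, $R^{1,(2)}_i=|\{j\le n:X^{(2)}_j\ge X^1_i\}|$ and $R^{2,(2)}_i=|\{j\le n:X^{(2)}_j\ge X^2_i\}|$, where $|\cdot|$ is cardinality. These may equal $0$, with the convention $k/0=\infty$. *)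

theory Defs
  imports "HOL-Probability.Probability"
begin

section \<open>Radon measures and the vague topology\<close>

text \<open>A measure on a subset \<open>F\<close> of a topological space is represented by a measure whose space is
  \<open>F\<close> and whose \<open>\<sigma>\<close>-algebra is the Borel \<open>\<sigma>\<close>-algebra of the subspace \<open>F\<close>.  The sets \<open>F\<close> used below
  are locally compact with a countable base, so that finiteness on compact sets characterizes
  Radon measures.\<close>

definition radon_measures :: "'a::topological_space set \<Rightarrow> 'a measure set" where
  "radon_measures F =
     {\<mu>. sets \<mu> = sets (restrict_space borel F) \<and> (\<forall>K. compact K \<and> K \<subseteq> F \<longrightarrow> emeasure \<mu> K < \<infinity>)}"

definition continuous_compact_support :: "'a::topological_space set \<Rightarrow> ('a \<Rightarrow> real) set" where
  "continuous_compact_support F =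
     {f. continuous_on F f \<and> (\<forall>x\<in>F. 0 \<le> f x) \<and>
         (\<exists>K. compact K \<and> K \<subseteq> F \<and> (\<forall>x\<in>F - K. f x = 0))}"

definition vague_topology :: "'a::topological_space set \<Rightarrow> 'a measure topology" where
  "vague_topology F = topology_generated_by
     {{\<mu> \<in> radon_measures F. (\<integral>x. f x \<partial>\<mu>) \<in> U} | f U.
        f \<in> continuous_compact_support F \<and> open U}"

lemma topspace_vague_topology [simp]: "topspace (vague_topology F) = radon_measures F"
proof -
  have "(\<lambda>_. 0) \<in> continuous_compact_support F"
    by (auto simp: continuous_compact_support_def intro!: exI[of _ "{}"])
  then have "radon_measures F \<in> {{\<mu> \<in> radon_measures F. (\<integral>x. f x \<partial>\<mu>) \<in> U} | f U.
        f \<in> continuous_compact_support F \<and> open U}"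
    by (intro CollectI exI[of _ "\<lambda>_. 0"] exI[of _ UNIV]) auto
  then show ?thesis
    unfolding vague_topology_def topology_generated_by_topspace by blast
qed

section \<open>Weak convergence of random elements of a topological space\<close>

definition borel_of :: "'a topology \<Rightarrow> 'a measure" where
  "borel_of T = sigma (topspace T) {U. openin T U}"

definition converges_weakly ::
  "'b topology \<Rightarrow> (nat \<Rightarrow> 'a measure) \<Rightarrow> (nat \<Rightarrow> 'a \<Rightarrow> 'b) \<Rightarrow> 'c measure \<Rightarrow> ('c \<Rightarrow> 'b) \<Rightarrow> bool" where
  "converges_weakly T M N M' Y \<longleftrightarrow>
     (\<forall>n. N n \<in> M n \<rightarrow>\<^sub>M borel_of T) \<and> Y \<in> M' \<rightarrow>\<^sub>M borel_of T \<and>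
     (\<forall>\<Phi>. continuous_map T euclideanreal \<Phi> \<and> bounded (\<Phi> ` topspace T) \<longrightarrow>
        (\<lambda>n. \<integral>\<omega>. \<Phi> (N n \<omega>) \<partial>M n) \<longlonglongrightarrow> (\<integral>\<omega>. \<Phi> (Y \<omega>) \<partial>M'))"

section \<open>Extreme value distributions\<close>

text \<open>The limit \<open>\<gamma> = 0\<close> of \<open>exp (- (1 + \<gamma> x) powr (- 1 / \<gamma>))\<close> is the Gumbel distribution;
  outside the set where \<open>1 + \<gamma> x > 0\<close> the distribution function is 0 below the left endpoint
  (\<open>\<gamma> > 0\<close>) and 1 above the right endpoint (\<open>\<gamma> < 0\<close>).\<close>

definition gev_cdf :: "real \<Rightarrow> real \<Rightarrow> real" where
  "gev_cdf \<gamma> x =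
     (if \<gamma> = 0 then exp (- exp (- x))
      else if 1 + \<gamma> * x > 0 then exp (- ((1 + \<gamma> * x) powr (- 1 / \<gamma>)))
      else if \<gamma> > 0 then 0 else 1)"

definition extreme_value_cdf :: "(real \<Rightarrow> real) \<Rightarrow> bool" where
  "extreme_value_cdf G \<longleftrightarrow> (\<exists>\<gamma> a b. a > 0 \<and> (\<forall>x. G x = gev_cdf \<gamma> (a * x + b)))"

definition neg_log :: "real \<Rightarrow> ennreal" where
  "neg_log p = (if p = 0 then \<infinity> else ennreal (- ln p))"

section \<open>Hidden domain of attraction, standard case\<close>

abbreviation pos_cone :: "(ereal \<times> ereal) set" where
  "pos_cone \<equiv> {0<..} \<times> {0<..}"

abbreviation full_cone :: "(ereal \<times> ereal) set" where
  "full_cone \<equiv> {-\<infinity><..} \<times> {-\<infinity><..}"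

text \<open>The measure \<open>n P[T(X) \<in> \<cdot>]\<close> on \<open>F\<close>, where \<open>\<mu>\<close> is the distribution of \<open>X\<close>.  Mass that \<open>T\<close>
  puts outside \<open>F\<close> is discarded.\<close>

definition scaled_law ::
  "(ereal \<times> ereal) set \<Rightarrow> (real \<times> real) measure \<Rightarrow> nat \<Rightarrow> (real \<times> real \<Rightarrow> ereal \<times> ereal)
     \<Rightarrow> (ereal \<times> ereal) measure" where
  "scaled_law F \<mu> n T = restrict_space (scale_measure (of_nat n) (distr \<mu> borel T)) F"

definition affine_normalize :: "real \<Rightarrow> real \<Rightarrow> real \<times> real \<Rightarrow> ereal \<times> ereal" where
  "affine_normalize a b x = (ereal ((fst x - b) / a), ereal ((snd x - b) / a))"

text \<open>In the second clause, \<open>E - {z \<in> E. z \<le> x}\<close> is the complement within \<open>E\<close>, and the identity is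
  required at all points \<open>x\<close> of \<open>E\<close> with finite coordinates; both sides may be infinite.\<close>

definition standard_hidden_domain_of_attraction ::
  "(ereal \<times> ereal) set \<Rightarrow> (real \<times> real) measure \<Rightarrow> bool" where
  "standard_hidden_domain_of_attraction E0 \<mu> \<longleftrightarrow>
     (E0 = full_cone \<or> E0 = pos_cone) \<and>
     distr \<mu> borel fst = distr \<mu> borel snd \<and>
     (\<exists>E a b \<nu> G1 G2.
        (E = UNIV - {(-\<infinity>, -\<infinity>)} \<or> E = {0..} \<times> {0..} - {(0, 0)}) \<and>
        (\<forall>n. a n > 0) \<and>
        limitin (vague_topology E) (\<lambda>n. scaled_law E \<mu> n (affine_normalize (a n) (b n)))
          \<nu> sequentially \<and>
        extreme_value_cdf G1 \<and> extreme_value_cdf G2 \<and>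
        (\<forall>x1 x2. (ereal x1, ereal x2) \<in> E \<longrightarrow>
           emeasure \<nu> (E - {z \<in> E. fst z \<le> ereal x1 \<and> snd z \<le> ereal x2})
             = neg_log (G1 x1) + neg_log (G2 x2))) \<and>
     (\<exists>c d \<nu>0.
        (\<forall>n. c n > 0) \<and>
        emeasure \<nu>0 (space \<nu>0) \<noteq> 0 \<and>
        limitin (vague_topology E0) (\<lambda>n. scaled_law E0 \<mu> n (affine_normalize (c n) (d n)))
          \<nu>0 sequentially)"

definition min_cdf :: "(real \<times> real) measure \<Rightarrow> real \<Rightarrow> real" where
  "min_cdf \<mu> = cdf (distr \<mu> borel (\<lambda>x. min (fst x) (snd x)))"

text \<open>In \<^typ>\<open>ereal\<close>, \<open>1 / 0 = \<infinity>\<close>.\<close>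

definition U_min :: "(real \<times> real) measure \<Rightarrow> real \<Rightarrow> ereal" where
  "U_min \<mu> x = 1 / ereal (1 - min_cdf \<mu> x)"

text \<open>The defining property of the limit measure on \<open>(0, \<infinity>]\<^sup>2\<close> associated with \<open>\<mu>\<close>.  Membership in
  \<^term>\<open>radon_measures pos_cone\<close> is part of \<^const>\<open>limitin\<close>.\<close>

definition is_hidden_limit_measure ::
  "(real \<times> real) measure \<Rightarrow> (ereal \<times> ereal) measure \<Rightarrow> bool" where
  "is_hidden_limit_measure \<mu> \<nu> \<longleftrightarrow>
     limitin (vague_topology pos_cone)
       (\<lambda>n. scaled_law pos_cone \<mu> n
          (\<lambda>x. (U_min \<mu> (fst x) / ereal (real n), U_min \<mu> (snd x) / ereal (real n))))
       \<nu> sequentially"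

section \<open>Modified anti-ranks and the rank-based empirical measure\<close>

definition anti_rank1 :: "(nat \<Rightarrow> real \<times> real) \<Rightarrow> nat \<Rightarrow> nat \<Rightarrow> nat" where
  "anti_rank1 x n i = card {j \<in> {1..n}. min (fst (x j)) (snd (x j)) \<ge> fst (x i)}"

definition anti_rank2 :: "(nat \<Rightarrow> real \<times> real) \<Rightarrow> nat \<Rightarrow> nat \<Rightarrow> nat" where
  "anti_rank2 x n i = card {j \<in> {1..n}. min (fst (x j)) (snd (x j)) \<ge> snd (x i)}"

text \<open>For \<open>k > 0\<close> all points \<open>(k / R\<^sup>1\<^sub>i, k / R\<^sup>2\<^sub>i)\<close> lie in \<open>(0, \<infinity>]\<^sup>2\<close>: in \<^typ>\<open>ereal\<close>, \<open>k / 0 = \<infinity>\<close>.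
  For \<open>k \<le> 0\<close>, which can only happen for finitely many \<open>n\<close> when \<open>k\<close> tends to infinity,
  the measure is 0.\<close>

definition rank_empirical_measure ::
  "(nat \<Rightarrow> real \<times> real) \<Rightarrow> nat \<Rightarrow> real \<Rightarrow> (ereal \<times> ereal) measure" where
  "rank_empirical_measure x n k =
     measure_of pos_cone (sets (restrict_space borel pos_cone))
       (\<lambda>A. ennreal (1 / k) *
          (\<Sum>i = 1..n. indicator A (ereal k / ereal (real (anti_rank1 x n i)),
                                    ereal k / ereal (real (anti_rank2 x n i)))))"

end

theory Submission
  imports Defs
begin

text \<open>Write \<open>h = 1 - H\<close> with \<open>H\<close> the distribution function of \<open>X\<^sup>1 \<and> X\<^sup>2\<close>, and \<open>s = n / k\<close>.
  In the coordinates \<open>1 / y\<close> the cone becomes the quadrant \<open>[0, \<infinity>)\<^sup>2\<close>, the points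
  \<open>(k / R\<^sup>1, k / R\<^sup>2)\<close> become \<open>(R\<^sup>1 / k, R\<^sup>2 / k)\<close>, and a law of large numbers
  (Chebyshev) applies to the points \<open>(s h(X\<^sup>1), s h(X\<^sup>2))\<close>.  It remains to compare the two point
  clouds on bounded sets.  The existence of the hidden limit measure alone forces
  \<open>P(h(X\<^sup>1 \<and> X\<^sup>2) \<le> u) \<sim> u\<close> as \<open>u \<rightarrow> 0\<close>, even if \<open>H\<close> has jumps, so the numbers of indices
  with \<open>s h \<le> t\<close> are close to \<open>k t\<close> for \<open>t\<close> in a finite grid.  By monotonicity of \<open>h\<close> these counts
  bracket all anti-ranks simultaneously, so that \<open>R / k\<close> is uniformly close to \<open>s h\<close>.\<close>

section \<open>Weak convergence to a constant\<close>

lemma (in prob_space) prob_tendsto_0_subset: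
  assumes "(\<lambda>n. prob (B n)) \<longlonglongrightarrow> 0" "\<And>n. B n \<in> events" "\<forall>\<^sub>F n in sequentially. A n \<subseteq> B n"
  shows "(\<lambda>n. prob (A n)) \<longlonglongrightarrow> 0"
proof (rule tendsto_sandwich[OF _ _ tendsto_const assms(1)])
  show "\<forall>\<^sub>F n in sequentially. prob (A n) \<le> prob (B n)"
    using assms(3) by eventually_elim (intro finite_measure_mono assms)
qed auto

lemma (in prob_space) prob_tendsto_0_Un:
  assumes "(\<lambda>n. prob (A n)) \<longlonglongrightarrow> 0" "(\<lambda>n. prob (B n)) \<longlonglongrightarrow> 0"
    "\<And>n. A n \<in> events" "\<And>n. B n \<in> events"
  shows "(\<lambda>n. prob (A n \<union> B n)) \<longlonglongrightarrow> 0"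
proof (rule tendsto_sandwich[OF _ _ tendsto_const])
  show "(\<lambda>n. prob (A n) + prob (B n)) \<longlonglongrightarrow> 0"
    using tendsto_add[OF assms(1,2)] by simp
  show "\<forall>\<^sub>F n in sequentially. prob (A n \<union> B n) \<le> prob (A n) + prob (B n)"
    by (intro always_eventually allI measure_Un_le assms)
qed auto

lemma (in prob_space) prob_tendsto_0_UN:
  assumes "finite I" "\<And>i. i \<in> I \<Longrightarrow> (\<lambda>n. prob (A i n)) \<longlonglongrightarrow> 0"
    "\<And>i n. i \<in> I \<Longrightarrow> A i n \<in> events"
  shows "(\<lambda>n. prob (\<Union>i\<in>I. A i n)) \<longlonglongrightarrow> 0"
  using assms
proof (induction I)
  case (insert i I)
  then have "(\<lambda>n. prob (A i n \<union> (\<Union>j\<in>I. A j n))) \<longlonglongrightarrow> 0"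
    by (intro prob_tendsto_0_Un) auto
  then show ?case by simp
qed simp

text \<open>For a deterministic limit, weak convergence follows from convergence in probability, and
  subbasic neighbourhoods suffice: the sets containing \<nu> that \<open>N n\<close> misses with
  vanishing probability are stable under finite intersections and under unions. Measurability into
  the discrete \<open>count_space UNIV\<close> turns every condition on \<open>N n\<close> into an
  event, so neither neighbourhoods nor \<Phi> need a separate measurability argument.\<close>

lemma converges_weakly_constI:
  assumes "prob_space M"
    and T: "T = topology_generated_by \<S>"
    and \<nu>: "\<nu> \<in> topspace T"
    and meas: "\<And>n. N n \<in> M \<rightarrow>\<^sub>M count_space UNIV"
    and top: "\<And>n \<omega>. \<omega> \<in> space M \<Longrightarrow> N n \<omega> \<in> topspace T"
    and lim: "\<And>S. S \<in> \<S> \<Longrightarrow> \<nu> \<in> S \<Longrightarrow> (\<lambda>n. measure M {\<omega>\<in>space M. N n \<omega> \<notin> S}) \<longlonglongrightarrow> 0"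
  shows "converges_weakly T (\<lambda>_. M) N M (\<lambda>_. \<nu>)"
proof -
  interpret prob_space M by fact
  have ev: "{\<omega>\<in>space M. N n \<omega> \<in> S} \<in> sets M" for n S
    using measurable_sets[OF meas, of S n] by (simp add: vimage_def Int_def conj_commute)
  have evn: "{\<omega>\<in>space M. N n \<omega> \<notin> S} \<in> sets M" for n S
    using ev[of n "- S"] by simp
  have borelN: "N n \<in> M \<rightarrow>\<^sub>M borel_of T" for n
    unfolding borel_of_def
  proof (rule measurable_measure_of)
    show "{U. openin T U} \<subseteq> Pow (topspace T)"
      by (auto dest: openin_subset)
    show "N n \<in> space M \<rightarrow> topspace T"
      using top by auto
    show "N n -` S \<inter> space M \<in> sets M" for S
      using measurable_sets[OF meas, of S n] by simp
  qed
  have nbhd: "(\<lambda>n. prob {\<omega>\<in>space M. N n \<omega> \<notin> S}) \<longlonglongrightarrow> 0"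
    if "generate_topology_on \<S> S" "\<nu> \<in> S" for S
    using that
  proof induction
    case (Int a b)
    show ?case
      by (rule prob_tendsto_0_subset[OF prob_tendsto_0_Un[of "\<lambda>n. {\<omega>\<in>space M. N n \<omega> \<notin> a}"
              "\<lambda>n. {\<omega>\<in>space M. N n \<omega> \<notin> b}"]]) (use Int evn in \<open>auto intro!: always_eventually\<close>)
  next
    case (UN K)
    then obtain k where k: "k \<in> K" "\<nu> \<in> k" by auto
    show ?case
      by (rule prob_tendsto_0_subset[OF UN.IH[OF k] evn]) (use k in \<open>auto intro!: always_eventually\<close>)
  qed (use lim in auto)
  have "(\<lambda>n. \<integral>\<omega>. \<Phi> (N n \<omega>) \<partial>M) \<longlonglongrightarrow> (\<integral>\<omega>. \<Phi> \<nu> \<partial>M)"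
    if \<Phi>: "continuous_map T euclideanreal \<Phi>" "bounded (\<Phi> ` topspace T)" for \<Phi>
  proof -
    obtain B where B: "B > 0" "\<And>x. x \<in> topspace T \<Longrightarrow> \<bar>\<Phi> x\<bar> \<le> B"
      using \<Phi>(2) by (auto simp: bounded_pos)
    have meas\<Phi>: "(\<lambda>\<omega>. \<Phi> (N n \<omega>)) \<in> borel_measurable M" for n
      using measurable_compose[OF meas, of \<Phi>] by simp
    have int: "integrable M (\<lambda>\<omega>. \<Phi> (N n \<omega>))" for n
      using B top by (intro integrable_const_bound[of _ B] AE_I2 meas\<Phi>) auto
    have "(\<lambda>n. \<integral>\<omega>. \<Phi> (N n \<omega>) \<partial>M) \<longlonglongrightarrow> \<Phi> \<nu>"
    proof (rule LIMSEQ_I)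
      fix r :: real assume r: "0 < r"
      \<comment> \<open>On \<open>S\<close> the integrand deviates by at most \<open>r / 2\<close>;
        off \<open>S\<close> it deviates by at most \<open>2 * B\<close>, so probability below
        \<open>r / (4 * B)\<close> there costs less than the other half of \<open>r\<close>.\<close>
      define S where "S = {x \<in> topspace T. \<Phi> x \<in> ball (\<Phi> \<nu>) (r / 2)}"
      have "openin T S"
        unfolding S_def using \<Phi>(1) by (rule openin_continuous_map_preimage) auto
      then have "(\<lambda>n. prob {\<omega>\<in>space M. N n \<omega> \<notin> S}) \<longlonglongrightarrow> 0"
        using \<nu> r by (intro nbhd) (auto simp: T S_def openin_topology_generated_by_iff)
      then have "\<forall>\<^sub>F n in sequentially. prob {\<omega>\<in>space M. N n \<omega> \<notin> S} < r / (4 * B)"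
        using r B by (intro order_tendstoD) auto
      then obtain n0 where n0: "\<And>n. n \<ge> n0 \<Longrightarrow> prob {\<omega>\<in>space M. N n \<omega> \<notin> S} < r / (4 * B)"
        by (auto simp: eventually_sequentially)
      have "norm ((\<integral>\<omega>. \<Phi> (N n \<omega>) \<partial>M) - \<Phi> \<nu>) < r" if "n \<ge> n0" for n
      proof -
        have "(\<integral>\<omega>. \<Phi> (N n \<omega>) \<partial>M) - \<Phi> \<nu> = (\<integral>\<omega>. \<Phi> (N n \<omega>) - \<Phi> \<nu> \<partial>M)"
          using int by (simp add: prob_space)
        also have "\<bar>\<dots>\<bar> \<le> (\<integral>\<omega>. \<bar>\<Phi> (N n \<omega>) - \<Phi> \<nu>\<bar> \<partial>M)"
          by (rule integral_abs_bound)
        also have "\<dots> \<le> (\<integral>\<omega>. r / 2 + 2 * B * indicator {\<omega>\<in>space M. N n \<omega> \<notin> S} \<omega> \<partial>M)"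
        proof (rule integral_mono)
          show "integrable M (\<lambda>\<omega>. r / 2 + 2 * B * indicator {\<omega>\<in>space M. N n \<omega> \<notin> S} \<omega>)"
            using evn by (intro Bochner_Integration.integrable_add integrable_const
                integrable_mult_right integrable_real_indicator) (auto simp: emeasure_eq_measure)
          fix \<omega> assume \<omega>: "\<omega> \<in> space M"
          have "\<bar>\<Phi> (N n \<omega>)\<bar> \<le> B" "\<bar>\<Phi> \<nu>\<bar> \<le> B"
            using B top \<omega> \<nu> by auto
          then show "\<bar>\<Phi> (N n \<omega>) - \<Phi> \<nu>\<bar> \<le> r / 2 + 2 * B * indicator {\<omega>\<in>space M. N n \<omega> \<notin> S} \<omega>"
            using \<omega> r top[OF \<omega>] by (auto simp: S_def indicator_def dist_real_def abs_minus_commute split: if_splits)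
        qed (use int in auto)
        also have "\<dots> = r / 2 + 2 * B * prob {\<omega>\<in>space M. N n \<omega> \<notin> S}"
          using evn[of n S] by (subst Bochner_Integration.integral_add)
            (auto simp: prob_space emeasure_eq_measure)
        also have "\<dots> < r / 2 + 2 * B * (r / (4 * B))"
          using n0[OF that] B by (intro add_strict_left_mono mult_strict_left_mono) auto
        also have "\<dots> = r" using B by (simp add: field_simps)
        finally show ?thesis by simp
      qed
      then show "\<exists>no. \<forall>n\<ge>no. norm ((\<integral>\<omega>. \<Phi> (N n \<omega>) \<partial>M) - \<Phi> \<nu>) < r" by blast
    qed
    then show ?thesis by (simp add: prob_space)
  qed
  then show ?thesis
    using borelN \<nu> by (auto simp: converges_weakly_def borel_of_def space_measure_of_conv intro!: measurable_const)
qed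

lemma integral_scale_measure:
  fixes f :: "'a \<Rightarrow> real"
  assumes "0 \<le> r" and [measurable]: "f \<in> borel_measurable M"
  shows "(\<integral>x. f x \<partial>scale_measure (ennreal r) M) = r * (\<integral>x. f x \<partial>M)"
proof -
  have "scale_measure (ennreal r) M = density M (\<lambda>_. ennreal r)"
    by (rule measure_eqI) (auto simp: emeasure_density_const)
  then show ?thesis
    using assms by (simp add: integral_density)
qed

lemma pos_cone_sets [measurable]: "pos_cone \<in> sets borel"
  by (intro borel_open open_Times) auto

section \<open>The rank-based empirical measure\<close>

lemma emeasure_distr_count_space:
  assumes "finite I" "p \<in> I \<rightarrow> space R" "A \<in> sets R"
  shows "emeasure (distr (count_space I) R p) A = (\<Sum>i\<in>I. indicator A (p i))"
proof -
  have "emeasure (distr (count_space I) R p) A = emeasure (count_space I) (p -` A \<inter> I)"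
    using assms by (subst emeasure_distr) auto
  also have "\<dots> = of_nat (card (p -` A \<inter> I))"
    using assms by (subst emeasure_count_space) auto
  also have "\<dots> = (\<Sum>i\<in>I. indicator A (p i))"
    using assms by (simp add: indicator_def of_bool_def sum.If_cases Int_def vimage_def conj_commute)
  finally show ?thesis .
qed

definition rank_point :: "(nat \<Rightarrow> real \<times> real) \<Rightarrow> nat \<Rightarrow> real \<Rightarrow> nat \<Rightarrow> ereal \<times> ereal" where
  "rank_point x n k i =
     (ereal k / ereal (real (anti_rank1 x n i)), ereal k / ereal (real (anti_rank2 x n i)))"

lemma rank_point_in_pos_cone: "0 < k \<Longrightarrow> rank_point x n k i \<in> pos_cone"
  by (auto simp: rank_point_def ereal_divide_eq)

text \<open>The set function inside \<open>measure_of\<close> becomes a scaled pushforward of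
  counting measure. This yields countable additivity at once and reduces integrals to finite
  sums.\<close>

lemma rank_empirical_measure_eq:
  assumes k: "0 < k"
  shows "rank_empirical_measure x n k = scale_measure (ennreal (1 / k))
    (distr (count_space {1..n}) (restrict_space borel pos_cone) (rank_point x n k))"
  unfolding rank_empirical_measure_def scale_measure_def sets_distr space_distr space_restrict_space2[OF pos_cone_sets]
proof (rule measure_of_eq)
  show "sets (restrict_space borel pos_cone) \<subseteq> Pow pos_cone"
    using sets.space_closed[of "restrict_space borel pos_cone"] by (simp add: space_restrict_space)
  fix A assume "A \<in> sigma_sets pos_cone (sets (restrict_space borel pos_cone))"
  then have "A \<in> sets (restrict_space borel pos_cone)"
    using sets.sigma_sets_eq[of "restrict_space borel pos_cone"] by (simp add: space_restrict_space)
  then show "ennreal (1 / k) * (\<Sum>i = 1..n. indicator A (ereal k / ereal (real (anti_rank1 x n i)),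
                                    ereal k / ereal (real (anti_rank2 x n i)))) =
    ennreal (1 / k) * emeasure (distr (count_space {1..n}) (restrict_space borel pos_cone) (rank_point x n k)) A"
    using rank_point_in_pos_cone[OF k]
    by (subst emeasure_distr_count_space) (auto simp: rank_point_def space_restrict_space)
qed

lemma sets_rank_empirical_measure:
  "sets (rank_empirical_measure x n k) = sets (restrict_space borel pos_cone)"
  using sets.space_closed[of "restrict_space borel pos_cone"]
    sets.sigma_sets_eq[of "restrict_space borel pos_cone"]
  by (simp add: rank_empirical_measure_def space_restrict_space sets_measure_of)

lemma rank_empirical_measure_radon:
  "rank_empirical_measure x n k \<in> radon_measures pos_cone"
proof (cases "0 < k")
  case True
  let ?D = "distr (count_space {1..n}) (restrict_space borel pos_cone) (rank_point x n k)"
  have "emeasure ?D K \<le> of_nat n" if "K \<in> sets ?D" for K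
  proof -
    have "emeasure ?D K = (\<Sum>i = 1..n. indicator K (rank_point x n k i))"
      using that rank_point_in_pos_cone[OF True]
      by (subst emeasure_distr_count_space) (auto simp: space_restrict_space)
    also have "\<dots> \<le> (\<Sum>i = 1..n. 1)"
      by (intro sum_mono) (auto simp: indicator_def)
    finally show ?thesis by simp
  qed
  then have "emeasure ?D K < \<infinity>" for K
    using le_less_trans[OF _ of_nat_less_top, of "emeasure ?D K" n] emeasure_notin_sets[of K ?D]
    by (cases "K \<in> sets ?D") (auto simp del: sets_distr)
  then show ?thesis
    using sets_rank_empirical_measure[of x n k]
    by (auto simp: radon_measures_def rank_empirical_measure_eq[OF True] ennreal_mult_less_top)
next
  case False
  \<comment> \<open>For \<open>k \<le> 0\<close> the factor \<open>ennreal (1 / k)\<close> is 0: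
    negative reals are truncated, and \<open>1 / 0 = 0\<close> in the reals.\<close>
  have 0: "emeasure (rank_empirical_measure x n k) A = 0" for A
  proof (cases "A \<in> sets (rank_empirical_measure x n k)")
    case True
    have "sets (restrict_space borel pos_cone) \<subseteq> Pow pos_cone"
      using sets.space_closed[of "restrict_space borel pos_cone"] by (simp add: space_restrict_space)
    with True False show ?thesis
      unfolding rank_empirical_measure_def
      by (subst emeasure_measure_of[OF refl])
       (simp_all add: ennreal_neg positive_def countably_additive_def)
  qed (simp add: emeasure_notin_sets)
  show ?thesis
    using sets_rank_empirical_measure[of x n k] by (auto simp: radon_measures_def 0)
qed

lemma integral_rank_empirical_measure:
  fixes f :: "ereal \<times> ereal \<Rightarrow> real"
  assumes k: "0 < k" and f: "f \<in> borel_measurable (restrict_space borel pos_cone)"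
  shows "(\<integral>z. f z \<partial>rank_empirical_measure x n k) = (\<Sum>i = 1..n. f (rank_point x n k i)) / k"
proof -
  have p: "rank_point x n k \<in> count_space {1..n} \<rightarrow>\<^sub>M restrict_space borel pos_cone"
    using rank_point_in_pos_cone[OF k] by (auto simp: space_restrict_space)
  show ?thesis
    unfolding rank_empirical_measure_eq[OF k] using f k
    by (subst integral_scale_measure)
      (simp_all del: One_nat_def add: integral_distr[OF p f] lebesgue_integral_count_space_finite)
qed

lemma continuous_compact_support_measurable:
  "f \<in> continuous_compact_support pos_cone \<Longrightarrow> f \<in> borel_measurable (restrict_space borel pos_cone)"
  by (auto simp: continuous_compact_support_def intro: borel_measurable_continuous_on_restrict)

section \<open>Scaling of nonnegative pairs near the origin\<close>

text \<open>Compactly supported test functions on the closed quadrant, extended to the plane by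
  clamping negative coordinates to 0. The extension allows continuity and estimates to be stated
  without domain conditions.\<close>

definition quadrant_test_function :: "real \<Rightarrow> (real \<times> real \<Rightarrow> real) \<Rightarrow> bool" where
  "quadrant_test_function T F \<longleftrightarrow> 0 < T \<and> continuous_on UNIV F \<and> (\<forall>p. 0 \<le> F p) \<and>
     (\<forall>u v. F (max 0 u, max 0 v) = F (u, v)) \<and> (\<forall>u v. T \<le> u \<or> T \<le> v \<longrightarrow> F (u, v) = 0)"

text \<open>A coordinate beyond \<open>T\<close> may be moved back to \<open>T\<close> because both
  values are 0. Hence the compact square \<open>[0, T] x [0, T]\<close> determines the function,
  which gives its bound and its uniform continuity.\<close>

lemma quadrant_test_function_clamp:
  assumes "quadrant_test_function T F"
  shows "F (u, v) = F (max 0 (min T u), max 0 (min T v))"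
proof -
  have "F (u, v) = F (min T u, min T v)"
    using assms by (cases "T \<le> u \<or> T \<le> v") (auto simp: quadrant_test_function_def min_def)
  then show ?thesis
    using assms by (simp add: quadrant_test_function_def)
qed

lemma quadrant_test_function_bounded:
  assumes F: "quadrant_test_function T F"
  obtains C where "0 < C" "\<And>p. F p \<le> C"
proof -
  have "compact ({0..T} \<times> {0..T})"
    by (intro compact_Times compact_Icc)
  moreover have "continuous_on ({0..T} \<times> {0..T}) F"
    using F by (auto simp: quadrant_test_function_def intro: continuous_on_subset)
  ultimately have "bounded (F ` ({0..T} \<times> {0..T}))"
    by (intro compact_imp_bounded compact_continuous_image)
  then obtain C where C: "C > 0" "\<And>p. p \<in> {0..T} \<times> {0..T} \<Longrightarrow> \<bar>F p\<bar> \<le> C"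
    by (auto simp: bounded_pos)
  have "F (u, v) \<le> C" for u v
    using C(2)[of "(max 0 (min T u), max 0 (min T v))"] F
    by (subst quadrant_test_function_clamp[OF F]) (auto simp: quadrant_test_function_def)
  with C(1) show ?thesis by (intro that) auto
qed

lemma clamp_contraction:
  fixes x y T :: real
  shows "\<bar>max 0 (min T x) - max 0 (min T y)\<bar> \<le> \<bar>x - y\<bar>"
proof -
  have "\<bar>max 0 a - max 0 b\<bar> \<le> \<bar>a - b\<bar>" for a b :: real by linarith
  then have "\<bar>max 0 (min T x) - max 0 (min T y)\<bar> \<le> \<bar>min T x - min T y\<bar>" .
  also have "\<dots> \<le> \<bar>x - y\<bar>" by linarith
  finally show ?thesis .
qed

lemma quadrant_test_function_uniformly_continuous:
  assumes F: "quadrant_test_function T F" and e: "0 < e"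
  obtains d where "0 < d"
    "\<And>u v u' v'. \<bar>u - u'\<bar> \<le> d \<Longrightarrow> \<bar>v - v'\<bar> \<le> d \<Longrightarrow> \<bar>F (u, v) - F (u', v')\<bar> \<le> e"
proof -
  have "compact ({0..T} \<times> {0..T})"
    by (intro compact_Times compact_Icc)
  moreover have "continuous_on ({0..T} \<times> {0..T}) F"
    using F by (auto simp: quadrant_test_function_def intro: continuous_on_subset)
  ultimately have "uniformly_continuous_on ({0..T} \<times> {0..T}) F"
    by (rule compact_uniformly_continuous[rotated])
  then obtain d where d: "d > 0"
    "\<And>p q. p \<in> {0..T} \<times> {0..T} \<Longrightarrow> q \<in> {0..T} \<times> {0..T} \<Longrightarrow> dist q p < d \<Longrightarrow> dist (F q) (F p) < e"
    using e unfolding uniformly_continuous_on_def by metis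
  let ?c = "\<lambda>x. max 0 (min T x)"
  \<comment> \<open>With \<open>d / 3\<close> per coordinate, the product distance, at most the sum
    of the coordinate distances, stays strictly below \<open>d\<close>.\<close>
  have "\<bar>F (u, v) - F (u', v')\<bar> \<le> e" if uv: "\<bar>u - u'\<bar> \<le> d / 3" "\<bar>v - v'\<bar> \<le> d / 3" for u v u' v'
  proof -
    have "dist (?c u, ?c v) (?c u', ?c v') \<le> \<bar>?c u - ?c u'\<bar> + \<bar>?c v - ?c v'\<bar>"
      by (simp add: dist_prod_def dist_real_def sqrt_sum_squares_le_sum_abs)
    also have "\<dots> \<le> \<bar>u - u'\<bar> + \<bar>v - v'\<bar>"
      by (intro add_mono clamp_contraction)
    also have "\<dots> < d" using uv d(1) by linarith
    finally have "dist (F (?c u, ?c v)) (F (?c u', ?c v')) < e"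
    proof (intro d(2) SigmaI)
      have "?c x \<in> {0..T}" for x
        using F by (simp add: quadrant_test_function_def)
      then show "?c u \<in> {0..T}" "?c v \<in> {0..T}" "?c u' \<in> {0..T}" "?c v' \<in> {0..T}" by blast+
    qed (simp add: dist_commute)
    then show ?thesis
      using quadrant_test_function_clamp[OF F] by (simp add: dist_real_def)
  qed
  then show ?thesis using d(1) by (intro that[of "d / 3"]) auto
qed

lemma quadrant_test_function_measurable:
  "quadrant_test_function T F \<Longrightarrow> F \<in> borel_measurable borel"
  by (auto simp: quadrant_test_function_def intro: borel_measurable_continuous_onI)

text \<open>A piecewise linear cutoff lying, on the quadrant, between the indicators of the squares
  of side \<open>a\<close> and \<open>b\<close>; the inner \<open>max 0\<close> makes it constant
  under clamping.\<close>

definition bump :: "real \<Rightarrow> real \<Rightarrow> real \<times> real \<Rightarrow> real" where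
  "bump a b p = max 0 (min 1 ((b - max 0 (max (fst p) (snd p))) / (b - a)))"

lemma bump_test_function:
  assumes "0 \<le> a" "a < b"
  shows "quadrant_test_function b (bump a b)"
  unfolding quadrant_test_function_def
proof (intro conjI allI impI)
  show "continuous_on UNIV (bump a b)"
    using assms unfolding bump_def by (intro continuous_intros) auto
  show "bump a b (max 0 u, max 0 v) = bump a b (u, v)" for u v
    by (simp add: bump_def ac_simps)
  show "bump a b (u, v) = 0" if "b \<le> u \<or> b \<le> v" for u v
  proof -
    have "(b - max 0 (max u v)) / (b - a) \<le> 0"
      using assms that by (intro divide_nonpos_pos) auto
    then show ?thesis by (simp add: bump_def)
  qed
qed (use assms in \<open>auto simp: bump_def\<close>)

lemma bump_le_1: "bump a b p \<le> 1"
  by (simp add: bump_def)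

lemma bump_eq_1: "0 \<le> a \<Longrightarrow> a < b \<Longrightarrow> u \<le> a \<Longrightarrow> v \<le> a \<Longrightarrow> bump a b (u, v) = 1"
  by (auto simp: bump_def field_simps)

text \<open>Convergence is assumed along integer scalings only, as a vague limit of a sequence
  provides it, while the sample is later scaled by the real numbers \<open>n / k\<close>.
  \<open>A\<close> and \<open>B\<close> stand for \<open>h\<close> at the two coordinates.\<close>

locale scaled_pair = prob_space P for P :: "'b measure" +
  fixes A B :: "'b \<Rightarrow> real"
  assumes A[measurable]: "A \<in> borel_measurable P" and B[measurable]: "B \<in> borel_measurable P"
    and A0: "\<And>x. 0 \<le> A x" and B0: "\<And>x. 0 \<le> B x"
    and conv: "\<And>T F. quadrant_test_function T F \<Longrightarrow>
      convergent (\<lambda>m. real m * (\<integral>x. F (real m * A x, real m * B x) \<partial>P))"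
begin

text \<open>This is the distribution function of the larger of \<open>A\<close> and
  \<open>B\<close>.\<close>

definition \<psi> :: "real \<Rightarrow> real" where
  "\<psi> u = prob {x \<in> space P. A x \<le> u \<and> B x \<le> u}"

lemma test_integrable:
  assumes F: "quadrant_test_function T F"
  shows "integrable P (\<lambda>x. F (s * A x, s * B x))"
proof -
  obtain C where C: "0 < C" "\<And>p. F p \<le> C"
    using quadrant_test_function_bounded[OF F] by blast
  note [measurable] = quadrant_test_function_measurable[OF F]
  show ?thesis
    using C F by (intro integrable_const_bound[of _ C]) (auto simp: quadrant_test_function_def)
qed

text \<open>The bump dominates the indicator of the smaller square. Together with
  \<open>bump_le_\<psi>\<close> this traps its integral between \<open>\<psi> (a / s)\<close> and
  \<open>\<psi> (b / s)\<close>.\<close>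

lemma \<psi>_le_bump:
  assumes "0 \<le> a" "a < b" "0 < s"
  shows "\<psi> (a / s) \<le> (\<integral>x. bump a b (s * A x, s * B x) \<partial>P)"
proof -
  have "\<psi> (a / s) = (\<integral>x. indicator {x \<in> space P. A x \<le> a / s \<and> B x \<le> a / s} x \<partial>P)"
    by (simp add: \<psi>_def)
  also have "\<dots> \<le> (\<integral>x. bump a b (s * A x, s * B x) \<partial>P)"
  proof (intro integral_mono)
    fix x
    show "indicator {x \<in> space P. A x \<le> a / s \<and> B x \<le> a / s} x \<le> bump a b (s * A x, s * B x)"
      using assms bump_eq_1[of a b "s * A x" "s * B x"]
      by (auto simp: indicator_def field_simps bump_def)
  qed (use assms test_integrable[OF bump_test_function] in \<open>auto simp: emeasure_eq_measure intro!: integrable_real_indicator\<close>)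
  finally show ?thesis .
qed

lemma bump_le_\<psi>:
  assumes "0 \<le> a" "a < b" "0 < s"
  shows "(\<integral>x. bump a b (s * A x, s * B x) \<partial>P) \<le> \<psi> (b / s)"
proof -
  have "(\<integral>x. bump a b (s * A x, s * B x) \<partial>P)
      \<le> (\<integral>x. indicator {x \<in> space P. A x \<le> b / s \<and> B x \<le> b / s} x \<partial>P)"
  proof (intro integral_mono)
    fix x assume "x \<in> space P"
    moreover have "bump a b (s * A x, s * B x) = 0" if "\<not> (A x \<le> b / s \<and> B x \<le> b / s)"
      using bump_test_function[OF assms(1,2)] that assms(3)
      by (auto simp: quadrant_test_function_def field_simps not_le)
    ultimately show "bump a b (s * A x, s * B x) \<le> indicator {x \<in> space P. A x \<le> b / s \<and> B x \<le> b / s} x"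
      using bump_le_1[of a b] by (auto simp: indicator_def)
  qed (use assms test_integrable[OF bump_test_function] in \<open>auto simp: emeasure_eq_measure intro!: integrable_real_indicator\<close>)
  then show ?thesis by (simp add: \<psi>_def)
qed

text \<open>A bump between \<open>T\<close> and \<open>T + 1\<close> has convergent, hence bounded,
  rescaled integrals, and these dominate \<open>m * \<psi> (T / m)\<close>.\<close>

lemma \<psi>_bound:
  assumes "0 < T"
  obtains C where "0 < C" "\<And>m. 0 < m \<Longrightarrow> real m * \<psi> (T / real m) \<le> C"
proof -
  have "Bseq (\<lambda>m. real m * (\<integral>x. bump T (T + 1) (real m * A x, real m * B x) \<partial>P))"
    using assms by (intro convergent_imp_Bseq conv[OF bump_test_function]) auto
  then obtain C where C: "C > 0"
    "\<And>m. norm (real m * (\<integral>x. bump T (T + 1) (real m * A x, real m * B x) \<partial>P)) \<le> C"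
    by (auto elim: BseqE)
  have "real m * \<psi> (T / real m) \<le> C" if "0 < m" for m
  proof -
    have "real m * \<psi> (T / real m) \<le> real m * (\<integral>x. bump T (T + 1) (real m * A x, real m * B x) \<partial>P)"
      using assms that by (intro mult_left_mono \<psi>_le_bump) auto
    also have "\<dots> \<le> C" using C(2)[of m] by simp
    finally show ?thesis .
  qed
  with C(1) show ?thesis by (intro that)
qed

text \<open>Compare \<open>s\<close> with its integer part \<open>m\<close>. Only points with both
  coordinates at most \<open>T / m\<close> contribute, and their mass is at most
  \<open>C / m\<close>. There the change of scale moves the argument of \<open>F\<close> by at most
  \<open>T / m\<close>, so the total error is at most \<open>(K / m + e) * C\<close>.\<close>

lemma real_scaling:
  assumes F: "quadrant_test_function T F"
    and l: "(\<lambda>m. real m * (\<integral>x. F (real m * A x, real m * B x) \<partial>P)) \<longlonglongrightarrow> l"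
  shows "((\<lambda>s. s * (\<integral>x. F (s * A x, s * B x) \<partial>P)) \<longlongrightarrow> l) at_top"
proof -
  have T: "0 < T" using F by (simp add: quadrant_test_function_def)
  obtain K where K: "0 < K" "\<And>p. F p \<le> K"
    using quadrant_test_function_bounded[OF F] by blast
  obtain C where C: "0 < C" "\<And>m. 0 < m \<Longrightarrow> real m * \<psi> (T / real m) \<le> C"
    using \<psi>_bound[OF T] by blast
  define I where "I s = (\<integral>x. F (s * A x, s * B x) \<partial>P)" for s
  define m where "m s = nat \<lfloor>s\<rfloor>" for s :: real
  have floor_top: "filterlim m at_top at_top"
    unfolding m_def by (rule filterlim_compose[OF filterlim_nat_sequentially filterlim_floor_sequentially])
  have "((\<lambda>s. s * I s - real (m s) * I (real (m s))) \<longlongrightarrow> 0) at_top"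
  proof (rule tendstoI)
    fix r :: real assume r: "0 < r"
    define e where "e = r / (4 * C)"
    have e: "0 < e" using r C by (simp add: e_def)
    obtain d where d: "0 < d"
      "\<And>u v u' v'. \<bar>u - u'\<bar> \<le> d \<Longrightarrow> \<bar>v - v'\<bar> \<le> d \<Longrightarrow> \<bar>F (u, v) - F (u', v')\<bar> \<le> e"
      using quadrant_test_function_uniformly_continuous[OF F e] by blast
    \<comment> \<open>Beyond \<open>T / d\<close> the displacement \<open>T / m\<close> is within
      the modulus of continuity; beyond \<open>4 * K * C / r\<close> the term
      \<open>K * C / m\<close> is below \<open>r / 4\<close>. The choice of \<open>e\<close> makes
      \<open>e * C\<close> equal to \<open>r / 4\<close>.\<close>
    obtain m0 :: nat where m0: "real m0 > max 1 (max (T / d) (4 * K * C / r))"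
      using reals_Archimedean2 by blast
    have "\<forall>\<^sub>F s in at_top. m0 \<le> m s"
      using floor_top by (simp add: filterlim_at_top)
    then show "\<forall>\<^sub>F s in at_top. dist (s * I s - real (m s) * I (real (m s))) 0 < r"
      using eventually_ge_at_top[of 1]
    proof eventually_elim
      case (elim s)
      let ?m = "real (m s)"
      define D where "D = {x \<in> space P. A x \<le> T / ?m \<and> B x \<le> T / ?m}"
      have m: "1 < ?m" "T / d < ?m" "4 * K * C / r < ?m"
        using m0 elim by linarith+
      have s: "?m \<le> s" "s - ?m \<le> 1"
        using elim(2) unfolding m_def by linarith+
      have Dm: "D \<in> events" unfolding D_def by measurable
      have eq: "s * I s - ?m * I ?m
          = (\<integral>x. s * F (s * A x, s * B x) - ?m * F (?m * A x, ?m * B x) \<partial>P)"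
        using test_integrable[OF F] by (simp add: I_def)
      have "\<bar>s * I s - ?m * I ?m\<bar> \<le> (\<integral>x. \<bar>s * F (s * A x, s * B x) - ?m * F (?m * A x, ?m * B x)\<bar> \<partial>P)"
        unfolding eq by (rule integral_abs_bound)
      also have "\<dots> \<le> (\<integral>x. (K + ?m * e) * indicator D x \<partial>P)"
      proof (rule integral_mono)
        show "integrable P (\<lambda>x. (K + ?m * e) * indicator D x)"
          by (intro integrable_mult_right integrable_real_indicator Dm) (simp add: emeasure_eq_measure)
        fix x assume x: "x \<in> space P"
        show "\<bar>s * F (s * A x, s * B x) - ?m * F (?m * A x, ?m * B x)\<bar> \<le> (K + ?m * e) * indicator D x"
        proof (cases "x \<in> D")
          case True
          have sm: "\<bar>s * z - ?m * z\<bar> \<le> d" if "0 \<le> z" "z \<le> T / ?m" for z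
          proof -
            have "\<bar>s * z - ?m * z\<bar> = (s - ?m) * z"
              using s that by (simp add: left_diff_distrib[symmetric] abs_mult)
            also have "\<dots> \<le> 1 * (T / ?m)"
              using s that m T by (intro mult_mono) auto
            also have "\<dots> \<le> d" using m d(1) by (simp add: field_simps)
            finally show ?thesis .
          qed
          \<comment> \<open>The difference is split into \<open>(s - m)\<close> times the value at
            scale \<open>s\<close>, bounded by \<open>K\<close> since \<open>s - m \<le> 1\<close>,
            and \<open>m\<close> times the difference of the values, bounded by
            \<open>m * e\<close>.\<close>
          have "\<bar>F (s * A x, s * B x) - F (?m * A x, ?m * B x)\<bar> \<le> e"
            using True A0 B0 by (intro d(2) sm) (auto simp: D_def)
          then have 1: "\<bar>?m * (F (s * A x, s * B x) - F (?m * A x, ?m * B x))\<bar> \<le> ?m * e"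
            using m by (simp add: abs_mult)
          have "0 \<le> F (s * A x, s * B x)"
            using F by (simp add: quadrant_test_function_def)
          then have "\<bar>(s - ?m) * F (s * A x, s * B x)\<bar> \<le> 1 * K"
            using s K unfolding abs_mult by (intro mult_mono) auto
          with 1 have "\<bar>(s - ?m) * F (s * A x, s * B x)
              + ?m * (F (s * A x, s * B x) - F (?m * A x, ?m * B x))\<bar> \<le> K + ?m * e"
            by linarith
          then show ?thesis using True by (simp add: algebra_simps)
        next
          case False
          have "T \<le> s * z" if "T / ?m < z" for z
          proof -
            have "T \<le> ?m * z" using that m by (simp add: field_simps)
            also have "\<dots> \<le> s * z"
            proof -
              have "0 < T / ?m" using T m by simp
              then show ?thesis using s that by (intro mult_right_mono) auto
            qed
            finally show ?thesis .
          qed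
          moreover have "T \<le> ?m * z" if "T / ?m < z" for z
            using that m by (simp add: field_simps)
          ultimately have "F (s * A x, s * B x) = 0" "F (?m * A x, ?m * B x) = 0"
            using False x F by (auto simp: quadrant_test_function_def not_le D_def)
          then show ?thesis using False by simp
        qed
      qed (use test_integrable[OF F] in auto)
      also have "\<dots> = (K + ?m * e) * \<psi> (T / ?m)"
        using Dm by (simp add: \<psi>_def D_def)
      also have "\<dots> = (K / ?m + e) * (?m * \<psi> (T / ?m))"
        using m by (simp add: field_simps)
      also have "\<dots> \<le> (K / ?m + e) * C"
        using m K e C by (intro mult_left_mono) auto
      also have "\<dots> < r"
      proof -
        have "K / ?m * C < r / 4" using m r by (simp add: field_simps)
        moreover have "e * C = r / 4" using C by (simp add: e_def)
        ultimately show ?thesis unfolding distrib_right using r by linarith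
      qed
      finally show ?case by (simp add: dist_real_def)
    qed
  qed
  moreover have "((\<lambda>s. real (m s) * I (real (m s))) \<longlongrightarrow> l) at_top"
    using filterlim_compose[OF l floor_top] by (simp add: I_def)
  ultimately have "((\<lambda>s. (s * I s - real (m s) * I (real (m s))) + real (m s) * I (real (m s))) \<longlongrightarrow> 0 + l) at_top"
    by (rule tendsto_add)
  then show ?thesis by (simp add: I_def)
qed

text \<open>Put \<open>g s = s \<psi>(1/s)\<close>.  The rescaled bump integral lies between \<open>g s\<close> and \<open>(1 + e) g (s / (1 + e))\<close>,
  and it converges; so the upper bound \<open>\<psi>(u) \<lesssim> u\<close>, which for a law with atoms is only available
  along a sequence \<open>u \<rightarrow> 0\<close>, extends to all small \<open>u\<close>.\<close>

lemma \<psi>_asymp: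
  assumes lower: "\<And>u. 0 < u \<Longrightarrow> u < 1 \<Longrightarrow> u \<le> \<psi> u"
    and upper: "\<And>\<delta>. 0 < \<delta> \<Longrightarrow> \<exists>u. 0 < u \<and> u < \<delta> \<and> prob {x \<in> space P. A x < u \<and> B x < u} \<le> u"
    and t: "0 < t"
  shows "((\<lambda>s. s * \<psi> (t / s)) \<longlongrightarrow> t) at_top"
proof -
  have one: "((\<lambda>s. s * \<psi> (1 / s)) \<longlongrightarrow> 1) at_top"
  proof (rule tendstoI)
    fix r :: real assume r: "0 < r"
    \<comment> \<open>With \<open>e \<le> 1\<close> the bound
      \<open>(1 + e)\<^sup>2 \<le> 1 + 3 * e\<close> holds; the factor 5 leaves room for the strict
      inequality \<open>I s < 1 + 4 * e\<close>.\<close>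
    define e where "e = min 1 (r / 5)"
    have e: "0 < e" "e \<le> 1" "5 * e \<le> r" using r by (auto simp: e_def)
    define I where "I s = s * (\<integral>x. bump 1 (1 + e) (s * A x, s * B x) \<partial>P)" for s
    have bump: "quadrant_test_function (1 + e) (bump 1 (1 + e))"
      using e by (intro bump_test_function) auto
    obtain l where l: "(I \<longlongrightarrow> l) at_top"
      using conv[OF bump] real_scaling[OF bump] unfolding I_def convergent_def by blast
    have "l \<le> (1 + e)\<^sup>2"
    proof (rule ccontr)
      assume "\<not> l \<le> (1 + e)\<^sup>2"
      then have "\<forall>\<^sub>F s in at_top. (1 + e)\<^sup>2 < I s"
        using order_tendstoD(1)[OF l] by auto
      then obtain s0 where s0: "\<And>s. s0 \<le> s \<Longrightarrow> (1 + e)\<^sup>2 < I s"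
        by (auto simp: eventually_at_top_linorder)
      obtain u where u: "0 < u" "u < (1 + e)\<^sup>2 / max 1 s0"
        "prob {x \<in> space P. A x < u \<and> B x < u} \<le> u"
        using upper[of "(1 + e)\<^sup>2 / max 1 s0"] e by auto
      \<comment> \<open>This choice gives \<open>(1 + e) / s = u / (1 + e) < u\<close>, so the
        non-strict level event lies inside the strict one, whose probability is at most
        \<open>u\<close>. The upper bound on \<open>u\<close> forces \<open>s\<close> beyond
        \<open>s0\<close>, where \<open>I s\<close> was supposed to exceed
        \<open>s * u\<close>.\<close>
      define s where "s = (1 + e)\<^sup>2 / u"
      have "max 1 s0 * u < (1 + e)\<^sup>2"
        using u(2) by (simp add: pos_less_divide_eq mult.commute)
      then have "max 1 s0 < s"
        unfolding s_def by (subst pos_less_divide_eq[OF u(1)])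
      then have s: "0 < s" "s0 \<le> s" by auto
      have "(\<integral>x. bump 1 (1 + e) (s * A x, s * B x) \<partial>P) \<le> \<psi> ((1 + e) / s)"
        using e s by (intro bump_le_\<psi>) auto
      also have "(1 + e) / s = u / (1 + e)"
        using e u by (simp add: s_def power2_eq_square)
      also have "\<psi> (u / (1 + e)) \<le> prob {x \<in> space P. A x < u \<and> B x < u}"
      proof -
        have "u / (1 + e) < u" using u e by (simp add: field_simps)
        then show ?thesis unfolding \<psi>_def by (intro finite_measure_mono) auto
      qed
      also have "\<dots> \<le> u" by fact
      finally have "I s \<le> s * u"
        unfolding I_def using s by (intro mult_left_mono) auto
      also have "s * u = (1 + e)\<^sup>2" using u by (simp add: s_def)
      finally show False using s0[OF s(2)] by simp
    qed
    also have "(1 + e)\<^sup>2 \<le> 1 + 3 * e"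
      using e by (simp add: power2_eq_square algebra_simps mult_left_le)
    finally have "\<forall>\<^sub>F s in at_top. I s < 1 + 4 * e"
      using e by (intro order_tendstoD(2)[OF l]) auto
    then show "\<forall>\<^sub>F s in at_top. dist (s * \<psi> (1 / s)) 1 < r"
      using eventually_gt_at_top[of 1]
    proof eventually_elim
      case (elim s)
      have "s * \<psi> (1 / s) \<le> I s"
        unfolding I_def using elim e by (intro mult_left_mono \<psi>_le_bump) auto
      moreover have "s * (1 / s) \<le> s * \<psi> (1 / s)"
        using elim by (intro mult_left_mono lower) auto
      ultimately show ?case
        using elim e by (simp add: dist_real_def)
    qed
  qed
  \<comment> \<open>A general level \<open>t\<close> reduces to level 1 by replacing
    \<open>s\<close> with \<open>s / t\<close>.\<close>
  have "filterlim (\<lambda>s. s * (1 / t)) at_top at_top"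
    using t by (intro filterlim_at_top_mult_tendsto_pos[OF tendsto_const _ filterlim_ident]) auto
  from tendsto_mult[OF tendsto_const[of t] filterlim_compose[OF one this]]
  show ?thesis using t by simp
qed

end

section \<open>Law of large numbers and tail levels\<close>

text \<open>Chebyshev's inequality for functions varying with \<open>n\<close>. From
  \<open>0 \<le> g \<le> C\<close> the second moment is at most \<open>C\<close> times the mean, so
  the variance of the sum over \<open>k\<close> is at most \<open>C / k\<close> times a convergent
  quantity and vanishes as \<open>k\<close> grows.\<close>

lemma (in prob_space) triangular_weak_law:
  fixes g :: "nat \<Rightarrow> 'b \<Rightarrow> real" and k :: "nat \<Rightarrow> real"
  assumes indep: "indep_vars (\<lambda>_. N) X UNIV"
    and law: "\<And>i. distr M N (X i) = D"
    and g[measurable]: "\<And>n. g n \<in> borel_measurable N"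
    and g0: "\<And>n x. 0 \<le> g n x" and gC: "\<And>n x. g n x \<le> C"
    and k: "filterlim k at_top sequentially"
    and l: "(\<lambda>n. real n / k n * (\<integral>x. g n x \<partial>D)) \<longlonglongrightarrow> l"
    and e: "0 < e"
  shows "(\<lambda>n. prob {\<omega>\<in>space M. e \<le> \<bar>(\<Sum>i = 1..n. g n (X i \<omega>)) / k n - l\<bar>}) \<longlonglongrightarrow> 0"
proof -
  have X[measurable]: "X i \<in> M \<rightarrow>\<^sub>M N" for i
    using indep by (simp add: indep_vars_def2)
  define m where "m n = (\<integral>x. g n x \<partial>D)" for n
  define S where "S n \<omega> = (\<Sum>i = 1..n. g n (X i \<omega>))" for n \<omega>
  have S[measurable]: "S n \<in> borel_measurable M" for n
    unfolding S_def by measurable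
  have int: "integrable M (\<lambda>\<omega>. g n (X i \<omega>))" for n i
    using g0 gC by (intro integrable_const_bound[of _ C]) auto
  have mean: "expectation (\<lambda>\<omega>. g n (X i \<omega>)) = m n" for n i
    unfolding m_def law[of i, symmetric] by (subst integral_distr) auto
  have m0: "0 \<le> m n" for n
    unfolding m_def using g0 by (intro integral_nonneg_AE) auto
  have ES: "expectation (S n) = n * m n" for n
    unfolding S_def using int mean by (simp add: Bochner_Integration.integral_sum)
  have var: "variance (S n) \<le> n * (C * m n)" for n
  proof -
    define Z where "Z i \<omega> = g n (X i \<omega>) - m n" for i \<omega>
    have Zm[measurable]: "Z i \<in> borel_measurable M" for i
      unfolding Z_def by measurable
    have Zb: "\<bar>Z i \<omega>\<bar> \<le> C + m n" for i \<omega>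
      using g0[of n "X i \<omega>"] gC[of n "X i \<omega>"] m0[of n] by (auto simp: Z_def)
    have intZ: "integrable M (Z i)" for i
      using Zb by (intro integrable_const_bound[of _ "C + m n"]) auto
    have intZZ: "integrable M (\<lambda>\<omega>. Z i \<omega> * Z j \<omega>)" for i j
    proof (intro integrable_const_bound[of _ "(C + m n) * (C + m n)"] AE_I2)
      fix \<omega>
      show "norm (Z i \<omega> * Z j \<omega>) \<le> (C + m n) * (C + m n)"
        unfolding norm_mult using Zb[of i \<omega>] Zb[of j \<omega>] by (intro mult_mono) auto
    qed measurable
    have EZ: "expectation (Z i) = 0" for i
      unfolding Z_def using int mean by (simp add: prob_space)
    have indZ: "indep_vars (\<lambda>_. borel) Z UNIV"
      unfolding Z_def by (rule indep_vars_compose2[OF indep]) measurable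
    have off: "expectation (\<lambda>\<omega>. Z i \<omega> * Z j \<omega>) = 0" if "i \<noteq> j" for i j
    proof -
      have "expectation (\<lambda>\<omega>. \<Prod>r\<in>{i, j}. Z r \<omega>) = (\<Prod>r\<in>{i, j}. expectation (Z r))"
        using intZ by (intro indep_vars_lebesgue_integral indep_vars_subset[OF indZ]) auto
      then show ?thesis using that EZ by simp
    qed
    have diag: "expectation (\<lambda>\<omega>. Z i \<omega> * Z i \<omega>) \<le> C * m n" for i
    proof -
      \<comment> \<open>The square is expanded and \<open>g\<close> squared is replaced by the
        larger \<open>C * g\<close>.\<close>
      have "Z i \<omega> * Z i \<omega> \<le> C * g n (X i \<omega>) - 2 * m n * g n (X i \<omega>) + m n * m n" for \<omega>
        using mult_right_mono[OF gC g0, of n "X i \<omega>" n "X i \<omega>"] by (simp add: Z_def algebra_simps)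
      then have "expectation (\<lambda>\<omega>. Z i \<omega> * Z i \<omega>)
          \<le> expectation (\<lambda>\<omega>. C * g n (X i \<omega>) - 2 * m n * g n (X i \<omega>) + m n * m n)"
        using int intZZ by (intro integral_mono) auto
      also have "\<dots> = C * m n - m n * m n"
        using int mean by (simp add: prob_space)
      also have "\<dots> \<le> C * m n" by simp
      finally show ?thesis .
    qed
    have "S n \<omega> - expectation (S n) = (\<Sum>i = 1..n. Z i \<omega>)" for \<omega>
      by (simp add: ES S_def Z_def sum_subtractf)
    then have "variance (S n) = expectation (\<lambda>\<omega>. \<Sum>i = 1..n. \<Sum>j = 1..n. Z i \<omega> * Z j \<omega>)"
      by (simp add: power2_eq_square sum_product)
    also have "\<dots> = (\<Sum>i = 1..n. \<Sum>j = 1..n. expectation (\<lambda>\<omega>. Z i \<omega> * Z j \<omega>))"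
      using intZZ by (simp add: Bochner_Integration.integral_sum)
    also have "\<dots> = (\<Sum>i = 1..n. \<Sum>j = 1..n. if i = j then expectation (\<lambda>\<omega>. Z i \<omega> * Z i \<omega>) else 0)"
      by (intro sum.cong refl) (simp add: off)
    also have "\<dots> = (\<Sum>i = 1..n. expectation (\<lambda>\<omega>. Z i \<omega> * Z i \<omega>))"
      by (intro sum.cong refl) (simp add: sum.delta)
    also have "\<dots> \<le> (\<Sum>i = 1..n. C * m n)"
      by (intro sum_mono diag)
    finally show ?thesis by simp
  qed
  have "\<forall>\<^sub>F n in sequentially. \<bar>real n / k n * m n - l\<bar> < e / 2"
    using tendstoD[OF l, of "e / 2"] e by (simp add: m_def dist_real_def)
  moreover have "\<forall>\<^sub>F n in sequentially. 0 < k n"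
    using k by (simp add: filterlim_at_top_dense)
  ultimately have bound: "\<forall>\<^sub>F n in sequentially.
      prob {\<omega>\<in>space M. e \<le> \<bar>S n \<omega> / k n - l\<bar>} \<le> 4 * C / e\<^sup>2 * (inverse (k n) * (real n / k n * m n))"
  proof eventually_elim
    case (elim n)
    \<comment> \<open>The normalized mean is already within \<open>e / 2\<close> of
      \<open>l\<close>, so a deviation \<open>e\<close> from \<open>l\<close> forces a deviation of
      at least \<open>e / 2\<close> from the mean.\<close>
    have "{\<omega>\<in>space M. e \<le> \<bar>S n \<omega> / k n - l\<bar>} \<subseteq> {\<omega>\<in>space M. k n * (e / 2) \<le> \<bar>S n \<omega> - expectation (S n)\<bar>}"
    proof safe
      fix \<omega> assume "e \<le> \<bar>S n \<omega> / k n - l\<bar>"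
      moreover have "e / 2 \<le> \<bar>a - b\<bar>" if "e \<le> \<bar>a - l\<bar>" "\<bar>b - l\<bar> < e / 2" for a b
        using that by linarith
      ultimately have "e / 2 \<le> \<bar>S n \<omega> / k n - real n / k n * m n\<bar>"
        using elim(1) by blast
      also have "S n \<omega> / k n - real n / k n * m n = (S n \<omega> - expectation (S n)) / k n"
        by (simp add: ES diff_divide_distrib)
      finally show "k n * (e / 2) \<le> \<bar>S n \<omega> - expectation (S n)\<bar>"
        using elim(2) by (simp add: field_simps abs_divide)
    qed
    then have "prob {\<omega>\<in>space M. e \<le> \<bar>S n \<omega> / k n - l\<bar>}
        \<le> prob {\<omega>\<in>space M. k n * (e / 2) \<le> \<bar>S n \<omega> - expectation (S n)\<bar>}"
      by (intro finite_measure_mono) auto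
    also have "\<dots> \<le> variance (S n) / (k n * (e / 2))\<^sup>2"
    proof (rule Chebyshev_inequality)
      show "integrable M (\<lambda>\<omega>. (S n \<omega>)\<^sup>2)"
      proof (intro integrable_const_bound[of _ "(real n * C)\<^sup>2"] AE_I2)
        fix \<omega>
        have "S n \<omega> \<le> (\<Sum>i = 1..n. C)" "0 \<le> S n \<omega>"
          unfolding S_def by (intro sum_mono gC, intro sum_nonneg g0)
        then show "norm ((S n \<omega>)\<^sup>2) \<le> (real n * C)\<^sup>2"
          by (simp add: power_mono)
      qed measurable
    qed (use elim e in auto)
    also have "\<dots> \<le> (real n * (C * m n)) / (k n * (e / 2))\<^sup>2"
      by (intro divide_right_mono var) auto
    also have "\<dots> = 4 * C / e\<^sup>2 * (inverse (k n) * (real n / k n * m n))"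
      using elim e by (simp add: field_simps power2_eq_square)
    finally show ?case .
  qed
  have "(\<lambda>n. 4 * C / e\<^sup>2 * (inverse (k n) * (real n / k n * m n))) \<longlonglongrightarrow> 4 * C / e\<^sup>2 * (0 * l)"
    using l unfolding m_def by (intro tendsto_mult tendsto_const tendsto_inverse_0_at_top[OF k])
  then have lim: "(\<lambda>n. 4 * C / e\<^sup>2 * (inverse (k n) * (real n / k n * m n))) \<longlonglongrightarrow> 0"
    by simp
  show ?thesis
    unfolding S_def[symmetric]
    by (rule tendsto_sandwich[OF _ bound tendsto_const lim]) simp
qed

context real_distribution
begin

lemma cdf_borel_measurable [measurable]: "cdf M \<in> borel_measurable borel"
  by (rule borel_measurable_mono) (simp add: mono_def cdf_nondecreasing)

text \<open>By right continuity the level set is a closed half-line starting at a quantile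
  \<open>x0\<close>. Strictly to the left of \<open>x0\<close> the distribution function is at most
  \<open>1 - u\<close>, hence so is its left limit, the mass below \<open>x0\<close>. Atoms can only
  make the inequality strict.\<close>

lemma survival_level_prob_ge:
  assumes u: "0 < u" "u < 1"
  shows "u \<le> prob {y. 1 - cdf M y \<le> u}"
proof -
  let ?S = "{y. 1 - cdf M y \<le> u}"
  have "\<forall>\<^sub>F x in at_top. 1 - u < cdf M x"
    using u by (intro order_tendstoD(1)[OF cdf_lim_at_top_prob]) auto
  then obtain x1 where "1 - u < cdf M x1"
    by (auto simp: eventually_at_top_linorder)
  then have ne: "?S \<noteq> {}" by (auto intro!: exI[of _ x1])
  have "\<forall>\<^sub>F x in at_bot. cdf M x < 1 - u"
    using u by (intro order_tendstoD(2)[OF cdf_lim_at_bot]) auto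
  then obtain x2 where x2: "cdf M x2 < 1 - u"
    by (auto simp: eventually_at_bot_linorder)
  have bdd: "bdd_below ?S"
  proof (rule bdd_belowI)
    fix y assume "y \<in> ?S"
    with x2 have "cdf M x2 < cdf M y" by simp
    then show "x2 \<le> y" using cdf_nondecreasing[of y x2] by linarith
  qed
  define x0 where "x0 = Inf ?S"
  have "1 - u \<le> cdf M x0"
  proof (rule tendsto_lowerbound)
    show "(cdf M \<longlongrightarrow> cdf M x0) (at_right x0)"
      using cdf_is_right_cont by (simp add: continuous_within)
    show "\<forall>\<^sub>F y in at_right x0. 1 - u \<le> cdf M y"
      unfolding eventually_at_right_field
    proof (intro exI[of _ "x0 + 1"] conjI allI impI)
      fix y assume "x0 < y"
      then obtain z where "z \<in> ?S" "z < y"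
        using cInf_less_iff[OF ne bdd] by (auto simp: x0_def)
      then show "1 - u \<le> cdf M y" using cdf_nondecreasing[of z y] by auto
    qed simp
  qed simp
  then have sub: "{x0..} \<subseteq> ?S"
    using cdf_nondecreasing[of x0] by force
  have "prob {..<x0} \<le> 1 - u"
  proof (rule tendsto_upperbound[OF cdf_at_left])
    show "\<forall>\<^sub>F y in at_left x0. cdf M y \<le> 1 - u"
      unfolding eventually_at_left_field
    proof (intro exI[of _ "x0 - 1"] conjI allI impI)
      fix y assume "y < x0"
      then have "y \<notin> ?S" using cInf_lower[OF _ bdd, of y] by (simp only: x0_def) linarith
      then show "cdf M y \<le> 1 - u" by simp
    qed simp
  qed simp
  moreover have "prob {x0..} = 1 - prob {..<x0}"
    using prob_compl[of "{..<x0}"] by (simp add: Compl_eq_Diff_UNIV[symmetric] Compl_lessThan)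
  ultimately have "u \<le> prob {x0..}" by simp
  also have "\<dots> \<le> prob ?S"
    using sub by (intro finite_measure_mono) auto
  finally show ?thesis .
qed

text \<open>A strictly smaller survival level forces a strictly larger point. In the presence of
  atoms the strict inequality matters, and the bound is obtained only at levels that the survival
  function attains.\<close>

lemma survival_level_prob_less_le: "prob {y. 1 - cdf M y < 1 - cdf M x} \<le> 1 - cdf M x"
proof -
  have "prob {y. 1 - cdf M y < 1 - cdf M x} \<le> prob {x<..}"
    using cdf_nondecreasing[of _ x] by (intro finite_measure_mono) (auto simp: not_le[symmetric])
  also have "\<dots> = 1 - cdf M x"
    using prob_compl[of "{..x}"] by (simp add: cdf_def Compl_eq_Diff_UNIV[symmetric] Compl_atMost)
  finally show ?thesis .
qed

end

section \<open>The cone in inverse coordinates\<close>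

lemma limitin_vague_integral:
  assumes "limitin (vague_topology S) N \<nu> sequentially" "f \<in> continuous_compact_support S"
  shows "(\<lambda>n. \<integral>x. f x \<partial>N n) \<longlonglongrightarrow> (\<integral>x. f x \<partial>\<nu>)"
proof (rule topological_tendstoI)
  fix U :: "real set" assume U: "open U" "(\<integral>x. f x \<partial>\<nu>) \<in> U"
  have "openin (vague_topology S) {\<mu> \<in> radon_measures S. (\<integral>x. f x \<partial>\<mu>) \<in> U}"
    unfolding vague_topology_def using assms(2) U(1) by (intro topology_generated_by_Basis) blast
  moreover have "\<nu> \<in> radon_measures S"
    using limitin_topspace[OF assms(1)] by simp
  ultimately have "\<forall>\<^sub>F n in sequentially. N n \<in> {\<mu> \<in> radon_measures S. (\<integral>x. f x \<partial>\<mu>) \<in> U}"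
    using assms(1) U(2) unfolding limitin_def by blast
  then show "\<forall>\<^sub>F n in sequentially. (\<integral>x. f x \<partial>N n) \<in> U"
    by eventually_elim simp
qed

text \<open>The function in the coordinates \<open>1 / y\<close>. Since \<open>inverse 0\<close> is
  infinite in \<open>ereal\<close>, the axes of the quadrant correspond to the points at infinity of
  the cone.\<close>

definition inverse_chart :: "(ereal \<times> ereal \<Rightarrow> real) \<Rightarrow> real \<times> real \<Rightarrow> real" where
  "inverse_chart f p = f (inverse (ereal (max 0 (fst p))), inverse (ereal (max 0 (snd p))))"

lemma inverse_ereal_nonneg_pos: "0 < inverse (ereal (max 0 x))"
  by (cases "x \<le> 0") (auto simp: max_def)

text \<open>A compact subset of the cone has both coordinates bounded away from 0, so its inverse
  coordinates are bounded; a cutoff beyond the larger of the two bounds works.\<close>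

lemma inverse_chart_test_function:
  assumes f: "f \<in> continuous_compact_support pos_cone"
  obtains T where "quadrant_test_function T (inverse_chart f)"
proof -
  obtain K where K: "compact K" "K \<subseteq> pos_cone" "\<And>y. y \<in> pos_cone - K \<Longrightarrow> f y = 0"
    and cont: "continuous_on pos_cone f" and f0: "\<And>y. y \<in> pos_cone \<Longrightarrow> 0 \<le> f y"
    using f by (auto simp: continuous_compact_support_def)
  have *: "\<exists>T. 0 < T \<and> (\<forall>y\<in>L. inverse (ereal T) < y)" if L: "compact L" "L \<subseteq> {0<..}" for L :: "ereal set"
  proof (cases "L = {}")
    case False
    obtain a where a: "a \<in> L" "\<And>y. y \<in> L \<Longrightarrow> a \<le> y"
      using compact_attains_inf[OF L(1) False] by metis
    \<comment> \<open>The minimum \<open>a\<close> may be infinite, so a positive real strictly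
      below it is inverted instead.\<close>
    obtain r where r: "0 < ereal r" "ereal r < a"
      using a(1) L(2) ereal_dense2[of 0 a] by auto
    then show ?thesis
      using a(2) by (intro exI[of _ "inverse r"]) (auto intro: less_le_trans)
  qed (auto intro: exI[of _ 1])
  obtain T1 where T1: "0 < T1" "\<And>y. y \<in> fst ` K \<Longrightarrow> inverse (ereal T1) < y"
    using *[of "fst ` K"] K(1,2) by (force intro!: compact_continuous_image continuous_intros)
  obtain T2 where T2: "0 < T2" "\<And>y. y \<in> snd ` K \<Longrightarrow> inverse (ereal T2) < y"
    using *[of "snd ` K"] K(1,2) by (force intro!: compact_continuous_image continuous_intros)
  let ?i = "\<lambda>x. inverse (ereal (max 0 x))"
  have in_cone: "(?i u, ?i v) \<in> pos_cone" for u v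
    using inverse_ereal_nonneg_pos by auto
  have small: "?i u \<le> inverse (ereal T')" if "0 < T'" "T' \<le> u" for T' u
    using that by (intro ereal_inverse_antimono) auto
  have "quadrant_test_function (max T1 T2) (inverse_chart f)"
    unfolding quadrant_test_function_def
  proof (intro conjI allI impI)
    have "continuous_on UNIV (\<lambda>x. inverse (ereal (max 0 (g x))))"
      if "continuous_on UNIV g" for g :: "real \<times> real \<Rightarrow> real"
      by (rule continuous_on_compose2[OF continuous_on_inverse_ereal])
        (auto intro!: continuous_intros that simp: le_max_iff_disj zero_ereal_def[symmetric])
    then show "continuous_on UNIV (inverse_chart f)"
      unfolding inverse_chart_def using in_cone
      by (intro continuous_on_compose2[OF cont] continuous_on_Pair)
        (blast intro: continuous_on_fst continuous_on_snd continuous_on_id)+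
    show "inverse_chart f (u, v) = 0" if "max T1 T2 \<le> u \<or> max T1 T2 \<le> v" for u v
    proof -
      have "(?i u, ?i v) \<notin> K"
        using that T1 T2 small[of T1 u] small[of T2 v] by force
      then show ?thesis
        using K(3)[of "(?i u, ?i v)"] in_cone by (simp add: inverse_chart_def)
    qed
  qed (use T1 f0 in_cone in \<open>auto simp: inverse_chart_def less_max_iff_disj\<close>)
  then show ?thesis by (rule that)
qed

definition inverse_pullback :: "(real \<times> real \<Rightarrow> real) \<Rightarrow> ereal \<times> ereal \<Rightarrow> real" where
  "inverse_pullback F y = F (real_of_ereal (inverse (fst y)), real_of_ereal (inverse (snd y)))"

lemma inverse_chart_pullback:
  "0 \<le> u \<Longrightarrow> 0 \<le> v \<Longrightarrow> inverse_chart (inverse_pullback F) (u, v) = F (u, v)"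
proof -
  have "real_of_ereal (inverse (inverse (ereal x))) = x" for x
    by (cases "x = 0") (auto simp: inverse_eq_divide)
  then show "0 \<le> u \<Longrightarrow> 0 \<le> v \<Longrightarrow> ?thesis"
    by (simp add: inverse_chart_def inverse_pullback_def)
qed

text \<open>In \<open>ereal\<close> the interval from \<open>1 / T\<close> to infinity is compact,
  so the square on it supports the pullback: outside, some inverse coordinate is at least
  \<open>T\<close>. Thus vague convergence on the cone controls every quadrant test
  function.\<close>

lemma inverse_pullback_compact_support:
  assumes F: "quadrant_test_function T F"
  shows "inverse_pullback F \<in> continuous_compact_support pos_cone"
proof -
  have T: "0 < T" using F by (simp add: quadrant_test_function_def)
  have cF: "continuous_on UNIV F" using F by (simp add: quadrant_test_function_def)
  have fin: "inverse y \<noteq> \<infinity> \<and> inverse y \<noteq> -\<infinity>" if "0 < y" for y :: ereal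
    using that by (cases y) auto
  have "continuous_on pos_cone (\<lambda>y. real_of_ereal (inverse (g y)))"
    if "continuous_on pos_cone g" "g ` pos_cone \<subseteq> {0<..}" for g :: "ereal \<times> ereal \<Rightarrow> ereal"
  proof (rule continuous_on_compose2[OF continuous_on_real])
    show "continuous_on pos_cone (\<lambda>y. inverse (g y))"
      using that by (intro continuous_on_compose2[OF continuous_on_inverse_ereal that(1)]) force
    show "(\<lambda>y. inverse (g y)) ` pos_cone \<subseteq> UNIV - {\<infinity>, - \<infinity>}"
      using that(2) fin by (auto simp: image_subset_iff)
  qed
  from this[of fst] this[of snd]
  have "continuous_on pos_cone (\<lambda>y. real_of_ereal (inverse (fst y)))"
    "continuous_on pos_cone (\<lambda>y. real_of_ereal (inverse (snd y)))"
    by (fastforce intro: continuous_on_fst continuous_on_snd continuous_on_id)+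
  then have "continuous_on pos_cone (inverse_pullback F)"
    unfolding inverse_pullback_def
    by (intro continuous_on_compose2[OF cF] continuous_on_Pair) auto
  moreover define K where "K = {inverse (ereal T)..} \<times> {inverse (ereal T)..}"
  have "compact K"
    unfolding K_def by (intro compact_Times) (simp_all add: compact_eq_closed)
  moreover have "K \<subseteq> pos_cone"
  proof -
    have "0 < inverse (ereal T)" using T by simp
    then show ?thesis unfolding K_def by (auto intro: less_le_trans)
  qed
  moreover have "inverse_pullback F y = 0" if "y \<in> pos_cone - K" for y
  proof -
    have "T \<le> real_of_ereal (inverse z)" if "0 < z" "z < inverse (ereal T)" for z
      using that T by (cases z) (auto simp: field_simps)
    then have "T \<le> real_of_ereal (inverse (fst y)) \<or> T \<le> real_of_ereal (inverse (snd y))"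
      using that by (force simp: not_le K_def)
    then show ?thesis
      using F unfolding inverse_pullback_def quadrant_test_function_def by blast
  qed
  moreover have "0 \<le> inverse_pullback F y" for y
    using F by (simp add: inverse_pullback_def quadrant_test_function_def)
  ultimately show ?thesis
    unfolding continuous_compact_support_def by blast
qed

lemma rank_point_inverse_chart:
  assumes "0 < k"
  shows "f (rank_point x n k i) = inverse_chart f (real (anti_rank1 x n i) / k, real (anti_rank2 x n i) / k)"
proof -
  have "ereal k / ereal (real r) = inverse (ereal (max 0 (real r / k)))" for r
    using assms by (cases "r = 0") (auto simp: max_def field_simps)
  then show ?thesis by (simp add: rank_point_def inverse_chart_def)
qed

lemma integral_scaled_law:
  fixes f :: "ereal \<times> ereal \<Rightarrow> real"
  assumes f: "f \<in> borel_measurable (restrict_space borel pos_cone)"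
    and S[measurable]: "S \<in> \<mu> \<rightarrow>\<^sub>M borel" and S_cone: "\<And>x. S x \<in> pos_cone"
  shows "(\<integral>y. f y \<partial>scaled_law pos_cone \<mu> n S) = real n * (\<integral>x. f (S x) \<partial>\<mu>)"
proof -
  have g[measurable]: "(\<lambda>y. indicator pos_cone y *\<^sub>R f y) \<in> borel_measurable borel"
    using f by (subst (asm) borel_measurable_restrict_space_iff) auto
  have "(\<integral>y. f y \<partial>scaled_law pos_cone \<mu> n S)
      = (\<integral>y. indicator pos_cone y *\<^sub>R f y \<partial>scale_measure (ennreal (real n)) (distr \<mu> borel S))"
    unfolding scaled_law_def by (subst integral_restrict_space) (auto simp: ennreal_of_nat_eq_real_of_nat)
  also have "\<dots> = real n * (\<integral>y. indicator pos_cone y *\<^sub>R f y \<partial>distr \<mu> borel S)"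
    by (rule integral_scale_measure) (use g in simp_all)
  also have "(\<integral>y. indicator pos_cone y *\<^sub>R f y \<partial>distr \<mu> borel S) = (\<integral>x. f (S x) \<partial>\<mu>)"
    unfolding integral_distr[OF S g] by (simp only: indicator_simps(1)[OF S_cone] scaleR_one)
  finally show ?thesis .
qed

text \<open>Finitely many natural numbers take only countably many joint values, so every preimage
  under \<open>H\<close> is a countable union of events, whatever the target set.\<close>

lemma measurable_finitely_determined:
  fixes R :: "'i \<Rightarrow> 'a \<Rightarrow> nat"
  assumes I: "finite I" and R[measurable]: "\<And>i. i \<in> I \<Longrightarrow> R i \<in> M \<rightarrow>\<^sub>M count_space UNIV"
    and H: "\<And>\<omega> \<omega>'. (\<And>i. i \<in> I \<Longrightarrow> R i \<omega> = R i \<omega>') \<Longrightarrow> H \<omega> = H \<omega>'"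
  shows "H \<in> M \<rightarrow>\<^sub>M count_space UNIV"
proof (rule measurableI)
  fix A
  \<comment> \<open>The outcome witnessing a value vector need not lie in \<open>space M\<close>,
    which is why the hypothesis on \<open>H\<close> ranges over all outcomes.\<close>
  let ?Q = "{r \<in> I \<rightarrow>\<^sub>E UNIV. \<exists>\<omega>. H \<omega> \<in> A \<and> (\<forall>i\<in>I. R i \<omega> = r i)}"
  have "H -` A \<inter> space M = (\<Union>r\<in>?Q. {\<omega>\<in>space M. \<forall>i\<in>I. R i \<omega> = r i})"
  proof (intro equalityI subsetI)
    fix \<omega> assume "\<omega> \<in> H -` A \<inter> space M"
    then show "\<omega> \<in> (\<Union>r\<in>?Q. {\<omega>\<in>space M. \<forall>i\<in>I. R i \<omega> = r i})"
      by (intro UN_I[of "restrict (\<lambda>i. R i \<omega>) I"]) auto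
  next
    fix \<omega> assume "\<omega> \<in> (\<Union>r\<in>?Q. {\<omega>\<in>space M. \<forall>i\<in>I. R i \<omega> = r i})"
    then obtain \<omega>' where "\<omega> \<in> space M" "H \<omega>' \<in> A" "\<And>i. i \<in> I \<Longrightarrow> R i \<omega> = R i \<omega>'" by auto
    then show "\<omega> \<in> H -` A \<inter> space M"
      using H[of \<omega> \<omega>'] by auto
  qed
  also have "\<dots> \<in> sets M"
  proof (intro sets.countable_UN'' countable_subset[OF _ countable_PiE[OF I]])
    show "{\<omega> \<in> space M. \<forall>i\<in>I. R i \<omega> = r i} \<in> sets M" for r
      using I by measurable
  qed auto
  finally show "H -` A \<inter> space M \<in> sets M" .
qed simp

text \<open>For fixed \<open>n\<close> and \<open>k\<close> the outcome enters only through the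
  \<open>2 * n\<close> anti-ranks, which are measurable as cardinalities of random finite
  sets.\<close>

lemma rank_empirical_measure_measurable:
  fixes X :: "nat \<Rightarrow> 'a \<Rightarrow> real \<times> real"
  assumes [measurable]: "\<And>i. X i \<in> borel_measurable M"
  shows "(\<lambda>\<omega>. rank_empirical_measure (\<lambda>i. X i \<omega>) n k) \<in> M \<rightarrow>\<^sub>M count_space UNIV"
proof (rule measurable_finitely_determined[where I = "{1..n} \<times> (UNIV :: bool set)" and
    R = "\<lambda>(i, b) \<omega>. if b then anti_rank1 (\<lambda>i. X i \<omega>) n i else anti_rank2 (\<lambda>i. X i \<omega>) n i"])
  fix ib :: "nat \<times> bool"
  have [measurable]: "(\<lambda>\<omega>. fst (X i \<omega>)) \<in> borel_measurable M" "(\<lambda>\<omega>. snd (X i \<omega>)) \<in> borel_measurable M" for i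
    using measurable_compose[OF assms borel_measurable_continuous_onI[OF continuous_on_fst[OF continuous_on_id]]]
      measurable_compose[OF assms borel_measurable_continuous_onI[OF continuous_on_snd[OF continuous_on_id]]] by auto
  have "(\<lambda>\<omega>. anti_rank1 (\<lambda>i. X i \<omega>) n i) \<in> M \<rightarrow>\<^sub>M count_space UNIV"
    "(\<lambda>\<omega>. anti_rank2 (\<lambda>i. X i \<omega>) n i) \<in> M \<rightarrow>\<^sub>M count_space UNIV" for i
    unfolding anti_rank1_def anti_rank2_def by (rule measurable_card, simp)+
  then show "(case ib of (i, b) \<Rightarrow> \<lambda>\<omega>. if b then anti_rank1 (\<lambda>i. X i \<omega>) n i else anti_rank2 (\<lambda>i. X i \<omega>) n i)
      \<in> M \<rightarrow>\<^sub>M count_space UNIV"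
    by (cases ib; cases "snd ib") auto
next
  fix \<omega> \<omega>'
  assume *: "\<And>ib. ib \<in> {1..n} \<times> UNIV \<Longrightarrow>
    (case ib of (i, b) \<Rightarrow> \<lambda>\<omega>. if b then anti_rank1 (\<lambda>i. X i \<omega>) n i else anti_rank2 (\<lambda>i. X i \<omega>) n i) \<omega> =
    (case ib of (i, b) \<Rightarrow> \<lambda>\<omega>. if b then anti_rank1 (\<lambda>i. X i \<omega>) n i else anti_rank2 (\<lambda>i. X i \<omega>) n i) \<omega>'"
  have "anti_rank1 (\<lambda>i. X i \<omega>) n i = anti_rank1 (\<lambda>i. X i \<omega>') n i"
    "anti_rank2 (\<lambda>i. X i \<omega>) n i = anti_rank2 (\<lambda>i. X i \<omega>') n i" if "i \<in> {1..n}" for i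
    using *[of "(i, True)"] *[of "(i, False)"] that by auto
  then show "rank_empirical_measure (\<lambda>i. X i \<omega>) n k = rank_empirical_measure (\<lambda>i. X i \<omega>') n k"
    unfolding rank_empirical_measure_def
    by (intro arg_cong[where f = "measure_of _ _"] ext arg_cong2[where f = "(*)"] sum.cong refl) simp
qed simp

section \<open>Comparison of anti-ranks and tail levels\<close>

text \<open>Since \<open>h\<close> is monotone, \<open>y \<le> m j\<close> implies \<open>s h(m j) \<le> t\<close> if \<open>s h(y) \<le> t\<close>, and is implied by it
  if \<open>t < s h(y)\<close>; no continuity of \<open>h\<close> is needed.\<close>

lemma survival_level_counts:
  fixes n J :: nat and m :: "nat \<Rightarrow> real" and h :: "real \<Rightarrow> real" and k s \<delta> y :: real
  defines "N \<equiv> \<lambda>t. real (card {j\<in>{1..n}. s * h (m j) \<le> t}) / k"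
    and "R \<equiv> \<lambda>y. real (card {j\<in>{1..n}. y \<le> m j}) / k"
  assumes h: "antimono h" "0 \<le> h y" and k: "0 < k" and s: "0 \<le> s" and \<delta>: "0 < \<delta>" and J: "1 \<le> J"
    and grid: "\<And>j. j \<in> {1..J} \<Longrightarrow> \<bar>N (real j * \<delta>) - real j * \<delta>\<bar> \<le> \<delta>"
  shows "s * h y \<le> real J * \<delta> \<Longrightarrow> \<bar>R y - s * h y\<bar> \<le> 2 * \<delta>"
    and "real J * \<delta> < s * h y \<Longrightarrow> (real J - 1) * \<delta> \<le> R y"
proof -
  have upper: "R y \<le> N t" if "s * h y \<le> t" for t
  proof -
    have "s * h (m j) \<le> t" if "y \<le> m j" for j
      using mult_left_mono[OF antimonoD[OF h(1) that] s] \<open>s * h y \<le> t\<close> by linarith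
    then show ?thesis
      unfolding R_def N_def using k by (intro divide_right_mono of_nat_mono card_mono) auto
  qed
  have lower: "N t \<le> R y" if "t < s * h y" for t
  proof -
    have "y \<le> m j" if "s * h (m j) \<le> t" for j
    proof (rule ccontr)
      assume "\<not> y \<le> m j"
      then have "s * h y \<le> s * h (m j)"
        using s by (intro mult_left_mono antimonoD[OF h(1)]) auto
      with that \<open>t < s * h y\<close> show False by linarith
    qed
    then show ?thesis
      unfolding R_def N_def using k by (intro divide_right_mono of_nat_mono card_mono) auto
  qed
  have R0: "0 \<le> R y" unfolding R_def using k by simp
  show "(real J - 1) * \<delta> \<le> R y" if "real J * \<delta> < s * h y"
    using lower[OF that] grid[of J] J by (auto simp: algebra_simps)
  show "\<bar>R y - s * h y\<bar> \<le> 2 * \<delta>" if le: "s * h y \<le> real J * \<delta>"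
  proof -
    \<comment> \<open>The first positive grid index with \<open>s * h y \<le> j * \<delta>\<close>.
      The counts at \<open>j\<close> and \<open>j - 1\<close> bracket the anti-rank; one grid step
      and one counting error give \<open>2 * \<delta>\<close>.\<close>
    define j where "j = max 1 (nat \<lceil>s * h y / \<delta>\<rceil>)"
    have G0: "0 \<le> s * h y" using s h by simp
    have "s * h y / \<delta> \<le> real J" using le \<delta> by (simp add: field_simps)
    then have jJ: "j \<in> {1..J}" using J by (auto simp: j_def ceiling_le_iff nat_le_iff)
    have "s * h y / \<delta> \<le> real j" unfolding j_def by linarith
    then have Gj: "s * h y \<le> real j * \<delta>" using \<delta> by (simp add: field_simps)
    have 1: "R y \<le> (real j + 1) * \<delta>"
      using upper[OF Gj] grid[OF jJ] by (auto simp: algebra_simps)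
    show ?thesis
    \<comment> \<open>In the lowest cell there is no grid point below; nonnegativity of both
      quantities replaces the lower bracket.\<close>
    proof (cases "j = 1")
      case True
      then show ?thesis using 1 Gj G0 R0 by (simp add: algebra_simps)
    next
      case False
      then have j2: "j - 1 \<in> {1..J}" "real (j - 1) = real j - 1" using jJ by auto
      have "real j - 1 < s * h y / \<delta>" using False unfolding j_def by linarith
      then have Gj': "(real j - 1) * \<delta> < s * h y" using \<delta> by (simp add: field_simps)
      have "\<bar>N ((real j - 1) * \<delta>) - (real j - 1) * \<delta>\<bar> \<le> \<delta>"
        using grid[OF j2(1)] unfolding j2(2) .
      then have "(real j - 1) * \<delta> - \<delta> \<le> R y"
        using lower[OF Gj'] by linarith
      then show ?thesis using 1 Gj Gj' by (simp add: algebra_simps)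
    qed
  qed
qed

text \<open>If both levels of an index are at most \<open>J * \<delta>\<close>, the two points are
  within \<open>2 * \<delta>\<close> in each coordinate and \<open>F\<close> changes by at most
  \<open>e\<close>; the grid count bounds the number of such indices by
  \<open>k * (J + 1) * \<delta>\<close>. Otherwise one coordinate is at least \<open>T\<close> for
  both points, so both values vanish.\<close>

lemma rank_sum_comparison:
  fixes n J :: nat and x :: "nat \<Rightarrow> real \<times> real" and h :: "real \<Rightarrow> real" and k s \<delta> T e :: real
  defines "N \<equiv> \<lambda>t. (\<Sum>i = 1..n. if s * h (min (fst (x i)) (snd (x i))) \<le> t then 1 else 0) / k"
  assumes h: "antimono h" "\<And>y. 0 \<le> h y" and k: "0 < k" and s: "0 \<le> s" and \<delta>: "0 < \<delta>" and J: "1 \<le> J"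
    and grid: "\<And>j. j \<in> {1..J} \<Longrightarrow> \<bar>N (real j * \<delta>) - real j * \<delta>\<bar> \<le> \<delta>"
    and F: "quadrant_test_function T F" and T: "T \<le> (real J - 1) * \<delta>"
    and e: "0 \<le> e"
      "\<And>u v u' v'. \<bar>u - u'\<bar> \<le> 2 * \<delta> \<Longrightarrow> \<bar>v - v'\<bar> \<le> 2 * \<delta> \<Longrightarrow> \<bar>F (u, v) - F (u', v')\<bar> \<le> e"
  shows "\<bar>(\<Sum>i = 1..n. F (real (anti_rank1 x n i) / k, real (anti_rank2 x n i) / k)) / k
      - (\<Sum>i = 1..n. F (s * h (fst (x i)), s * h (snd (x i)))) / k\<bar> \<le> e * ((real J + 1) * \<delta>)"
proof -
  let ?m = "\<lambda>i. min (fst (x i)) (snd (x i))"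
  have N: "N t = real (card {j\<in>{1..n}. s * h (?m j) \<le> t}) / k" for t
    by (simp add: N_def sum.If_cases Int_def)
  note cmp = survival_level_counts[where h = h and m = ?m and s = s and k = k and n = n, folded N,
      OF h k s \<delta> J grid]
  have r1: "real (anti_rank1 x n i) / k = real (card {j\<in>{1..n}. fst (x i) \<le> ?m j}) / k" for i
    by (simp add: anti_rank1_def)
  have r2: "real (anti_rank2 x n i) / k = real (card {j\<in>{1..n}. snd (x i) \<le> ?m j}) / k" for i
    by (simp add: anti_rank2_def)
  have point: "\<bar>F (real (anti_rank1 x n i) / k, real (anti_rank2 x n i) / k)
      - F (s * h (fst (x i)), s * h (snd (x i)))\<bar> \<le> e * (if s * h (?m i) \<le> real J * \<delta> then 1 else 0)" for i
  proof (cases "s * h (fst (x i)) \<le> real J * \<delta> \<and> s * h (snd (x i)) \<le> real J * \<delta>")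
    case True
    then have "s * h (?m i) \<le> real J * \<delta>" by (simp add: min_def)
    moreover have "\<bar>F (real (anti_rank1 x n i) / k, real (anti_rank2 x n i) / k)
      - F (s * h (fst (x i)), s * h (snd (x i)))\<bar> \<le> e"
      unfolding r1 r2 using True by (intro e(2) cmp(1)) auto
    ultimately show ?thesis by simp
  next
    case False
    have "T \<le> s * h y \<and> T \<le> real (card {j\<in>{1..n}. y \<le> ?m j}) / k" if "real J * \<delta> < s * h y" for y
    proof -
      have "(real J - 1) * \<delta> \<le> real (card {j\<in>{1..n}. y \<le> ?m j}) / k"
        using that by (intro cmp(2))
      then show ?thesis using T that \<delta> by (simp add: left_diff_distrib)
    qed
    then have "T \<le> s * h (fst (x i)) \<and> T \<le> real (anti_rank1 x n i) / k \<or>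
        T \<le> s * h (snd (x i)) \<and> T \<le> real (anti_rank2 x n i) / k"
      unfolding r1 r2 using False by (meson not_le)
    then have "F (real (anti_rank1 x n i) / k, real (anti_rank2 x n i) / k) = 0"
      "F (s * h (fst (x i)), s * h (snd (x i))) = 0"
      using F unfolding quadrant_test_function_def by blast+
    then show ?thesis using e by simp
  qed
  have "\<bar>(\<Sum>i = 1..n. F (real (anti_rank1 x n i) / k, real (anti_rank2 x n i) / k)) / k
      - (\<Sum>i = 1..n. F (s * h (fst (x i)), s * h (snd (x i)))) / k\<bar>
    = \<bar>\<Sum>i = 1..n. F (real (anti_rank1 x n i) / k, real (anti_rank2 x n i) / k)
      - F (s * h (fst (x i)), s * h (snd (x i)))\<bar> / k"
    using k by (simp add: sum_subtractf diff_divide_distrib[symmetric] abs_divide)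
  also have "\<dots> \<le> (\<Sum>i = 1..n. e * (if s * h (?m i) \<le> real J * \<delta> then 1 else 0)) / k"
    using k by (intro divide_right_mono order_trans[OF sum_abs] sum_mono point) auto
  also have "\<dots> = e * N (real J * \<delta>)"
    by (simp only: N_def sum_distrib_left[symmetric] times_divide_eq_right)
  also have "\<dots> \<le> e * ((real J + 1) * \<delta>)"
    using grid[of J] J e by (intro mult_left_mono) (auto simp: algebra_simps)
  finally show ?thesis .
qed

section \<open>Tails under hidden domain of attraction\<close>

locale hidden_tail = prob_space \<mu> for \<mu> :: "(real \<times> real) measure" +
  fixes \<nu> :: "(ereal \<times> ereal) measure"
  assumes sets_law[measurable_cong]: "sets \<mu> = sets borel"
    and hidden: "is_hidden_limit_measure \<mu> \<nu>"
begin

definition h :: "real \<Rightarrow> real" where "h y = 1 - min_cdf \<mu> y"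

lemma space_law: "space \<mu> = UNIV"
  using sets_eq_imp_space_eq[OF sets_law] by simp

lemma fst_law[measurable]: "fst \<in> borel_measurable \<mu>" and snd_law[measurable]: "snd \<in> borel_measurable \<mu>"
  unfolding measurable_cong_sets[OF sets_law refl]
  by (auto intro!: borel_measurable_continuous_onI continuous_intros)

sublocale minimum: real_distribution "distr \<mu> borel (\<lambda>x. min (fst x) (snd x))"
  by (rule real_distribution_distr) measurable

lemma h_eq: "h y = 1 - cdf (distr \<mu> borel (\<lambda>x. min (fst x) (snd x))) y"
  by (simp add: h_def min_cdf_def)

lemma antimono_h: "antimono h"
  unfolding h_eq antimono_def using minimum.cdf_nondecreasing by simp

lemma h_nonneg: "0 \<le> h y"
  unfolding h_eq using minimum.cdf_bounded_prob by simp

lemma h_measurable[measurable]: "h \<in> borel_measurable borel"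
  unfolding h_eq[abs_def] by measurable

text \<open>As \<open>h\<close> is antimonotone, its value at the minimum is the larger of the two
  values. This identifies \<open>\<psi>\<close> with the law of \<open>h\<close> at the
  coordinatewise minimum.\<close>

lemma h_min_le: "h (min a b) \<le> t \<longleftrightarrow> h a \<le> t \<and> h b \<le> t"
  using antimonoD[OF antimono_h, of a b] antimonoD[OF antimono_h, of b a]
  by (auto simp: min_def)

lemma h_min_less: "h (min a b) < t \<longleftrightarrow> h a < t \<and> h b < t"
  using antimonoD[OF antimono_h, of a b] antimonoD[OF antimono_h, of b a]
  by (auto simp: min_def)

text \<open>For \<open>m > 0\<close>, dividing \<open>U_min\<close> by \<open>m\<close> gives the
  extended inverse of \<open>m * h\<close>, also where \<open>h\<close> vanishes. Hence the vague
  limit reads off directly in inverse coordinates.\<close>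

lemma integer_scaling:
  assumes f: "f \<in> continuous_compact_support pos_cone"
  shows "(\<lambda>m. real m * (\<integral>x. inverse_chart f (real m * h (fst x), real m * h (snd x)) \<partial>\<mu>))
    \<longlonglongrightarrow> (\<integral>y. f y \<partial>\<nu>)"
proof -
  let ?S = "\<lambda>m x. (U_min \<mu> (fst x) / ereal (real m), U_min \<mu> (snd x) / ereal (real m))"
  have U: "U_min \<mu> y / ereal (real m) = inverse (ereal (max 0 (real m * h y)))" if "0 < m" for y m
    using that h_nonneg[of y] unfolding U_min_def h_def[symmetric]
    by (cases "h y = 0") (auto simp: max_def one_ereal_def field_simps)
  have "(\<integral>y. f y \<partial>scaled_law pos_cone \<mu> m (?S m))
      = real m * (\<integral>x. inverse_chart f (real m * h (fst x), real m * h (snd x)) \<partial>\<mu>)" if "0 < m" for m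
  proof -
    have S: "?S m = (\<lambda>x. (inverse (ereal (max 0 (real m * h (fst x)))), inverse (ereal (max 0 (real m * h (snd x))))))"
      by (simp add: U[OF that])
    have "(\<integral>y. f y \<partial>scaled_law pos_cone \<mu> m (?S m)) = real m * (\<integral>x. f (?S m x) \<partial>\<mu>)"
    proof (rule integral_scaled_law)
      show "f \<in> borel_measurable (restrict_space borel pos_cone)"
        by (rule continuous_compact_support_measurable[OF f])
      show "?S m \<in> borel_measurable \<mu>"
        unfolding S by measurable
      show "?S m x \<in> pos_cone" for x
        unfolding U[OF that] by (intro SigmaI) (simp_all only: greaterThan_iff inverse_ereal_nonneg_pos)
    qed
    then show ?thesis
      by (simp only: inverse_chart_def U[OF that] fst_conv snd_conv)
  qed
  then have "\<forall>\<^sub>F m in sequentially. (\<integral>y. f y \<partial>scaled_law pos_cone \<mu> m (?S m))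
      = real m * (\<integral>x. inverse_chart f (real m * h (fst x), real m * h (snd x)) \<partial>\<mu>)"
    using eventually_gt_at_top[of 0] by (rule eventually_mono[rotated])
  moreover have "(\<lambda>m. \<integral>y. f y \<partial>scaled_law pos_cone \<mu> m (?S m)) \<longlonglongrightarrow> (\<integral>y. f y \<partial>\<nu>)"
    using hidden f unfolding is_hidden_limit_measure_def by (rule limitin_vague_integral)
  ultimately show ?thesis
    using tendsto_cong by fast
qed

sublocale tails: scaled_pair \<mu> "\<lambda>x. h (fst x)" "\<lambda>x. h (snd x)"
proof
  fix T F assume F: "quadrant_test_function T F"
  have "inverse_chart (inverse_pullback F) (real m * h a, real m * h b) = F (real m * h a, real m * h b)" for m a b
    using h_nonneg by (intro inverse_chart_pullback) auto
  then show "convergent (\<lambda>m. real m * (\<integral>x. F (real m * h (fst x), real m * h (snd x)) \<partial>\<mu>))"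
    using integer_scaling[OF inverse_pullback_compact_support[OF F]] by (auto simp: convergent_def)
qed (auto simp: h_nonneg)

lemma tail_scaling:
  assumes f: "f \<in> continuous_compact_support pos_cone"
  shows "((\<lambda>s. s * (\<integral>x. inverse_chart f (s * h (fst x), s * h (snd x)) \<partial>\<mu>)) \<longlongrightarrow> (\<integral>y. f y \<partial>\<nu>)) at_top"
proof -
  obtain T where "quadrant_test_function T (inverse_chart f)"
    using inverse_chart_test_function[OF f] .
  then show ?thesis
    using tails.real_scaling integer_scaling[OF f] by blast
qed

lemma level_prob_eq: "tails.\<psi> u = minimum.prob {y. h y \<le> u}"
  unfolding tails.\<psi>_def by (subst measure_distr) (auto simp: space_law h_min_le intro!: arg_cong[where f = prob])

lemma tail_level_asymp:
  assumes t: "0 < t"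
  shows "((\<lambda>s. s * tails.\<psi> (t / s)) \<longlongrightarrow> t) at_top"
proof (rule tails.\<psi>_asymp[OF _ _ t])
  show lower: "u \<le> tails.\<psi> u" if "0 < u" "u < 1" for u
    unfolding level_prob_eq using minimum.survival_level_prob_ge[OF that, folded h_eq] .
  show "\<exists>u. 0 < u \<and> u < \<delta> \<and> prob {x \<in> space \<mu>. h (fst x) < u \<and> h (snd x) < u} \<le> u"
    if \<delta>: "0 < \<delta>" for \<delta>
  proof -
    define d where "d = min \<delta> 1 / 2"
    have d: "0 < d" "d < 1" "d < \<delta>" using \<delta> by (auto simp: d_def)
    obtain C where C: "0 < C" "\<And>m. 0 < m \<Longrightarrow> real m * tails.\<psi> (1 / real m) \<le> C"
      using tails.\<psi>_bound[of 1] by auto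
    \<comment> \<open>If \<open>h\<close> had no value above \<open>1 / m\<close> and at most
      \<open>d\<close>, then \<open>\<psi>\<close> would agree at both levels, contradicting
      \<open>m * \<psi> (1 / m) \<le> C < m * d \<le> m * \<psi> d\<close>. So \<open>h\<close>
      attains arbitrarily small positive values, and such a value serves as
      \<open>u\<close>.\<close>
    obtain m :: nat where m: "C / d < real m"
      using reals_Archimedean2 by blast
    have m0: "0 < real m"
      using m C d by (meson divide_pos_pos less_trans)
    have "real m * tails.\<psi> (1 / real m) \<le> C" using C(2) m0 by simp
    also have "C < real m * d" using m d by (simp add: pos_divide_less_eq)
    finally have "real m * tails.\<psi> (1 / real m) < real m * d" .
    then have "tails.\<psi> (1 / real m) < tails.\<psi> d"
      using lower[OF d(1,2)] m0 by simp
    then have "\<not> {y. h y \<le> d} \<subseteq> {y. h y \<le> 1 / real m}"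
      unfolding level_prob_eq using minimum.finite_measure_mono[of "{y. h y \<le> d}" "{y. h y \<le> 1 / real m}"]
      by auto
    then obtain y where y: "h y \<le> d" "1 / real m < h y"
      unfolding subset_iff mem_Collect_eq not_all not_imp not_le by blast
    have "prob {x \<in> space \<mu>. h (fst x) < h y \<and> h (snd x) < h y} = minimum.prob {z. h z < h y}"
      by (subst measure_distr) (auto simp: space_law h_min_less intro!: arg_cong[where f = prob])
    also have "\<dots> \<le> h y"
      unfolding h_eq by (rule minimum.survival_level_prob_less_le)
    finally show ?thesis
      using y d m0 by (intro exI[of _ "h y"]) (auto intro: less_trans[of 0 "1 / real m"])
  qed
qed

end

theorem proposition2p9:
  fixes M :: "'a measure"
    and X :: "nat \<Rightarrow> 'a \<Rightarrow> real \<times> real"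
    and k :: "nat \<Rightarrow> real"
    and E0 :: "(ereal \<times> ereal) set"
    and \<nu> :: "(ereal \<times> ereal) measure"
  assumes "prob_space M"
    and "prob_space.indep_vars M (\<lambda>_. borel) X UNIV"
    and "\<And>i. distr M borel (X i) = distr M borel (X 0)"
    and "standard_hidden_domain_of_attraction E0 (distr M borel (X 0))"
    and "is_hidden_limit_measure (distr M borel (X 0)) \<nu>"
    and "filterlim k at_top sequentially"
    and "filterlim (\<lambda>n. real n / k n) at_top sequentially"
  shows "converges_weakly (vague_topology pos_cone) (\<lambda>_. M)
           (\<lambda>n \<omega>. rank_empirical_measure (\<lambda>i. X i \<omega>) n (k n)) M (\<lambda>_. \<nu>)"
proof -
  interpret prob_space M by fact
  note k = assms(6)
  define s where "s n = real n / k n" for n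
  have s: "filterlim s at_top sequentially" using assms(7) by (simp add: s_def[abs_def])
  have X[measurable]: "X i \<in> borel_measurable M" for i
    using assms(2) by (simp add: indep_vars_def2)
  define \<mu> where "\<mu> = distr M borel (X 0)"
  have law: "distr M borel (X i) = \<mu>" for i using assms(3) by (simp add: \<mu>_def)
  interpret law: prob_space \<mu> unfolding \<mu>_def by (rule prob_space_distr) simp
  interpret hidden_tail \<mu> \<nu>
    using assms(5) by unfold_locales (simp_all add: \<mu>_def)
  let ?N = "\<lambda>n \<omega>. rank_empirical_measure (\<lambda>i. X i \<omega>) n (k n)"
  \<comment> \<open>The law of large numbers is applied to two families: \<open>G\<close> evaluates
    a test function at the true scaled levels, and \<open>L\<close> counts the minima below a level,
    with mean \<open>\<psi> (t / s n)\<close>.\<close>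
  define G where "G f n p = inverse_chart f (s n * h (fst p), s n * h (snd p))" for f n p
  define L where "L t n p = (if s n * h (min (fst p) (snd p)) \<le> t then 1 else 0 :: real)" for t n p
  have kpos: "\<forall>\<^sub>F n in sequentially. 0 < k n"
    using k by (simp add: filterlim_at_top_dense)
  have spos: "\<forall>\<^sub>F n in sequentially. 0 < s n"
    using s by (simp add: filterlim_at_top_dense)
  have [measurable]: "fst \<in> borel_measurable (borel :: (real \<times> real) measure)"
    "snd \<in> borel_measurable (borel :: (real \<times> real) measure)"
    by (auto intro!: borel_measurable_continuous_onI continuous_intros)
  have L_meas[measurable]: "L t n \<in> borel_measurable borel" for t n
    unfolding L_def by measurable
  have L_lim: "(\<lambda>n. prob {\<omega>\<in>space M. \<delta> \<le> \<bar>(\<Sum>i = 1..n. L t n (X i \<omega>)) / k n - t\<bar>}) \<longlonglongrightarrow> 0"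
    if "0 < t" "0 < \<delta>" for t \<delta>
  proof (rule triangular_weak_law[OF assms(2) law L_meas _ _ k _ that(2)])
    have "(\<lambda>n. s n * tails.\<psi> (t / s n)) \<longlonglongrightarrow> t"
      by (rule filterlim_compose[OF tail_level_asymp[OF that(1)] s])
    moreover have "\<forall>\<^sub>F n in sequentially. s n * tails.\<psi> (t / s n) = real n / k n * (\<integral>x. L t n x \<partial>\<mu>)"
      using spos
    proof eventually_elim
      case (elim n)
      have "tails.\<psi> (t / s n) = (\<integral>x. indicator {x \<in> space \<mu>. h (fst x) \<le> t / s n \<and> h (snd x) \<le> t / s n} x \<partial>\<mu>)"
        by (simp add: tails.\<psi>_def)
      also have "\<dots> = (\<integral>x. L t n x \<partial>\<mu>)"
      proof (intro Bochner_Integration.integral_cong refl)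
        have "s n * h (min a b) \<le> t \<longleftrightarrow> h (min a b) \<le> t / s n" for a b
          using elim by (simp add: pos_le_divide_eq mult.commute)
        then have "s n * h (min a b) \<le> t \<longleftrightarrow> h a \<le> t / s n \<and> h b \<le> t / s n" for a b
          by (simp only: h_min_le)
        then show "indicator {x \<in> space \<mu>. h (fst x) \<le> t / s n \<and> h (snd x) \<le> t / s n} p = L t n p" for p
          by (simp add: L_def space_law indicator_def)
      qed
      finally show ?case by (simp add: s_def)
    qed
    ultimately show "(\<lambda>n. real n / k n * (\<integral>x. L t n x \<partial>\<mu>)) \<longlonglongrightarrow> t"
      using tendsto_cong by fast
  qed (auto simp: L_def)
  have key: "(\<lambda>n. prob {\<omega>\<in>space M. ?N n \<omega> \<notin> S}) \<longlonglongrightarrow> 0"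
    if f: "f \<in> continuous_compact_support pos_cone" and U: "open U" "(\<integral>y. f y \<partial>\<nu>) \<in> U"
      and S: "S = {\<mu> \<in> radon_measures pos_cone. (\<integral>y. f y \<partial>\<mu>) \<in> U}" for f U S
  proof -
    define l where "l = (\<integral>y. f y \<partial>\<nu>)"
    obtain r where r: "0 < r" "ball l r \<subseteq> U"
      using U openE unfolding l_def by blast
    obtain T where T: "quadrant_test_function T (inverse_chart f)"
      using inverse_chart_test_function[OF f] .
    have T0: "0 < T" using T by (simp add: quadrant_test_function_def)
    obtain C where C: "0 < C" "\<And>p. inverse_chart f p \<le> C"
      using quadrant_test_function_bounded[OF T] by blast
    \<comment> \<open>The mesh below gives \<open>(J + 1) * \<delta> \<le> T + 3\<close>, so the
      comparison error becomes at most \<open>r / 4\<close>.\<close>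
    define e where "e = r / (4 * (T + 3))"
    have e: "0 < e" using r T0 by (simp add: e_def)
    obtain d where d: "0 < d" "\<And>u v u' v'. \<bar>u - u'\<bar> \<le> d \<Longrightarrow> \<bar>v - v'\<bar> \<le> d \<Longrightarrow>
        \<bar>inverse_chart f (u, v) - inverse_chart f (u', v')\<bar> \<le> e"
      using quadrant_test_function_uniformly_continuous[OF T e] by blast
    define \<delta> where "\<delta> = min 1 (d / 2)"
    have \<delta>: "0 < \<delta>" "\<delta> \<le> 1" "2 * \<delta> \<le> d" using d by (auto simp: \<delta>_def)
    \<comment> \<open>The extra 1 leaves one cell beyond \<open>T\<close>: a counting error of
      \<open>\<delta>\<close> at the last grid point must still keep the anti-rank level at least
      \<open>T\<close>.\<close>
    define J where "J = nat \<lceil>T / \<delta>\<rceil> + 1"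
    have J: "1 \<le> J" "T / \<delta> \<le> real J - 1" "real J - 1 < T / \<delta> + 1"
      using T0 \<delta> ceiling_correct[of "T / \<delta>"] by (auto simp: J_def)
    have TJ: "T \<le> (real J - 1) * \<delta>"
      using J(2) \<delta>(1) by (simp add: pos_divide_le_eq)
    have "(real J - 1) * \<delta> < T + \<delta>"
      using mult_strict_right_mono[OF J(3) \<delta>(1)] \<delta>(1) by (simp add: distrib_right)
    then have "(real J + 1) * \<delta> \<le> T + 3"
      using \<delta>(2) by (simp add: algebra_simps)
    then have "e * ((real J + 1) * \<delta>) \<le> e * (T + 3)"
      using e by (intro mult_left_mono) auto
    also have "\<dots> = r / 4" unfolding e_def using T0 by (simp add: divide_simps)
    finally have eJ: "e * ((real J + 1) * \<delta>) \<le> r / 4" .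
    have G_meas[measurable]: "G f n \<in> borel_measurable borel" for n
      unfolding G_def using quadrant_test_function_measurable[OF T] by measurable
    have G_lim: "(\<lambda>n. prob {\<omega>\<in>space M. r / 2 \<le> \<bar>(\<Sum>i = 1..n. G f n (X i \<omega>)) / k n - l\<bar>}) \<longlonglongrightarrow> 0"
    proof (rule triangular_weak_law[OF assms(2) law G_meas _ _ k])
      show "(\<lambda>n. real n / k n * (\<integral>x. G f n x \<partial>\<mu>)) \<longlonglongrightarrow> l"
        using filterlim_compose[OF tail_scaling[OF f] s] by (simp add: G_def l_def s_def)
      show "0 \<le> G f n p" for n p
        using T unfolding G_def quadrant_test_function_def by blast
      show "G f n p \<le> C" for n p
        unfolding G_def by (rule C)
    qed (use r in auto)
    \<comment> \<open>The bad event: some grid count is off by \<open>\<delta>\<close>, or the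
      empirical integral at the true levels is off by \<open>r / 2\<close>. It is a finite union of
      events of vanishing probability, and outside it the total error is below
      \<open>r / 4 + r / 2 < r\<close>.\<close>
    let ?B = "\<lambda>n. (\<Union>j\<in>{1..J}. {\<omega>\<in>space M. \<delta> \<le> \<bar>(\<Sum>i = 1..n. L (real j * \<delta>) n (X i \<omega>)) / k n - real j * \<delta>\<bar>})
      \<union> {\<omega>\<in>space M. r / 2 \<le> \<bar>(\<Sum>i = 1..n. G f n (X i \<omega>)) / k n - l\<bar>}"
    have "(\<lambda>n. prob (?B n)) \<longlonglongrightarrow> 0"
      using \<delta> by (intro prob_tendsto_0_Un prob_tendsto_0_UN L_lim G_lim) auto
    then show ?thesis
    proof (rule prob_tendsto_0_subset)
      show "?B n \<in> events" for n by measurable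
      show "\<forall>\<^sub>F n in sequentially. {\<omega>\<in>space M. ?N n \<omega> \<notin> S} \<subseteq> ?B n"
        using kpos spos
      proof eventually_elim
        case (elim n)
        show ?case
        proof (rule subsetI, rule ccontr)
          fix \<omega> assume \<omega>: "\<omega> \<in> {\<omega>\<in>space M. ?N n \<omega> \<notin> S}" and notB: "\<omega> \<notin> ?B n"
          let ?x = "\<lambda>i. X i \<omega>"
          have grid: "\<bar>(\<Sum>i = 1..n. L (real j * \<delta>) n (X i \<omega>)) / k n - real j * \<delta>\<bar> \<le> \<delta>"
            if "j \<in> {1..J}" for j
          proof -
            have "\<omega> \<notin> {\<omega>\<in>space M. \<delta> \<le> \<bar>(\<Sum>i = 1..n. L (real j * \<delta>) n (X i \<omega>)) / k n - real j * \<delta>\<bar>}"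
              using notB that by blast
            then show ?thesis using \<omega> unfolding mem_Collect_eq by linarith
          qed
          have "\<omega> \<notin> {\<omega>\<in>space M. r / 2 \<le> \<bar>(\<Sum>i = 1..n. G f n (X i \<omega>)) / k n - l\<bar>}"
            using notB by blast
          then have lln: "\<bar>(\<Sum>i = 1..n. G f n (X i \<omega>)) / k n - l\<bar> < r / 2"
            using \<omega> unfolding mem_Collect_eq by linarith
          have "\<bar>(\<Sum>i = 1..n. inverse_chart f (real (anti_rank1 ?x n i) / k n, real (anti_rank2 ?x n i) / k n)) / k n
              - (\<Sum>i = 1..n. inverse_chart f (s n * h (fst (?x i)), s n * h (snd (?x i)))) / k n\<bar>
              \<le> e * ((real J + 1) * \<delta>)"
          proof (rule rank_sum_comparison[OF antimono_h h_nonneg elim(1) less_imp_le[OF elim(2)] \<delta>(1) J(1) _ T TJ])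
            show "\<bar>(\<Sum>i = 1..n. if s n * h (min (fst (?x i)) (snd (?x i))) \<le> real j * \<delta> then 1 else 0) / k n
              - real j * \<delta>\<bar> \<le> \<delta>" if "j \<in> {1..J}" for j
              using grid[OF that] by (simp add: L_def)
          qed (use e d(2) \<delta>(3) in auto)
          then have "\<bar>(\<integral>y. f y \<partial>?N n \<omega>) - (\<Sum>i = 1..n. G f n (X i \<omega>)) / k n\<bar> \<le> r / 4"
            using eJ unfolding G_def
              integral_rank_empirical_measure[OF elim(1) continuous_compact_support_measurable[OF f]]
              rank_point_inverse_chart[OF elim(1)] by linarith
          then have "\<bar>(\<integral>y. f y \<partial>?N n \<omega>) - l\<bar> < r" using lln r by linarith
          then have "(\<integral>y. f y \<partial>?N n \<omega>) \<in> U"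
            using r(2) by (auto simp: dist_real_def abs_minus_commute)
          then show False
            using \<omega> rank_empirical_measure_radon by (simp add: S)
        qed
      qed
    qed
  qed
  show ?thesis
  proof (rule converges_weakly_constI[OF assms(1) vague_topology_def])
    show "\<nu> \<in> topspace (vague_topology pos_cone)"
      using hidden unfolding is_hidden_limit_measure_def by (rule limitin_topspace)
  qed (use key in \<open>auto intro: rank_empirical_measure_measurable rank_empirical_measure_radon\<close>)
qed

end
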